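(* (1) For a positive integer $t$, let $\mathscr{A}_{\leq 2t}$ be the set of all ambiguous conjugacy classes of $\Gamma=\mathrm{PSL}(2,\mathbb{Z})$ of length at most $2t$. Then $$|\mathscr{A}_{\leq 2t}|\simeq 2^{t/2}.$$ (2) As $t\to\infty$, the number of primitive ambiguous classes of length at most $2t$ is asymptotic ($\sim$) to the number $|\mathscr{A}_{\leq 2t}|$ of all ambiguous classes of length at most $2t$.
   Context: $\Gamma=\mathrm{PSL}(2,\mathbb{Z})$, with $A:z\mapsto -1/z$ and $B:z\mapsto -1/(z+1)$. Then $\Gamma$ is the free product $\langle A\rangle * \langle B\rangle\cong\mathbb{Z}_2*\mathbb{Z}_3$. For $\gamma\in\Gamma$, $\|\gamma\|$ is the word length with respect to the generating set $\{A,B,B^{-1}\}$, and the length of a conjugacy class is $\|[\gamma]\|=\min\{\|h\|:h\in[\gamma]\}$. Let $w=\begin{pmatrix}1&0\\0&-1\end{pmatrix}\in\mathrm{PGL}(2,\mathbb{Z})$ and $\phi_{Amb}(\gamma)=w^{-1}\gamma^{-1} w$, an anti-automorphism of $\Gamma$, which acts on conjugacy classes. Let $P$ be the set of primitive hyperbolic elements of $\Gamma$ (hyperbolic: absolute trace $>2$; primitive: not a proper power in $\Gamma$), and $\langle P\rangle=\{\prod_{i=1}^n p_i^{k_i}: n\ge1, p_i\in P, k_i\in\mathbb{Z}\}$. An ambiguous class is a $\Gamma$-conjugacy class $\{p\}$ of an element $p\in\langle P\rangle$ with $\phi_{Amb}(\{p\})=\{p\}$. A conjugacy class is primitive if its elements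 are not proper powers in $\Gamma$. For real-valued functions, $f\sim g$ means $f(t)/g(t)\to1$ as $t\to\infty$, and $f\simeq g$ means that there exist positive constants $C_1,C_2,C_3,C_4$ and $t_0$ such that $C_1g(t)+C_3\le f(t)\le C_2g(t)+C_4$ for all $t\ge t_0$. *)

theory Defs
  imports "HOL-Analysis.Analysis" "HOL-Algebra.Coset"
begin

section \<open>The modular group\<close>

definition GL2Z :: "(int^2^2) monoid" where
  "GL2Z = \<lparr>carrier = {M. invertible M}, monoid.mult = (**), one = mat 1\<rparr>"

definition SL2Z :: "(int^2^2) monoid" where
  "SL2Z = \<lparr>carrier = {M. det M = 1}, monoid.mult = (**), one = mat 1\<rparr>"

definition pm_one :: "(int^2^2) set" where
  "pm_one = {mat 1, - mat 1}"

text \<open>Elements of both quotients are sets of the form \<open>{M, - M}\<close>, and both multiplications are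
  the product of subsets, so \<open>PSL2Z\<close> is literally a subgroup of \<open>PGL2Z\<close>.\<close>

definition PGL2Z :: "(int^2^2) set monoid" where
  "PGL2Z = GL2Z Mod pm_one"

definition PSL2Z :: "(int^2^2) set monoid" where
  "PSL2Z = SL2Z Mod pm_one"

definition proj :: "int^2^2 \<Rightarrow> (int^2^2) set" where
  "proj M = pm_one #>\<^bsub>GL2Z\<^esub> M"

text \<open>The Moebius transformations \<open>z \<mapsto> -1/z\<close> and \<open>z \<mapsto> -1/(z+1)\<close>; \<open>vector\<close> lists the rows.\<close>

definition gen_A :: "(int^2^2) set" where
  "gen_A = proj (vector [vector [0, -1], vector [1, 0]])"

definition gen_B :: "(int^2^2) set" where
  "gen_B = proj (vector [vector [0, -1], vector [1, 1]])"

definition elt_w :: "(int^2^2) set" where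
  "elt_w = proj (vector [vector [1, 0], vector [0, -1]])"


section \<open>Word length and conjugacy classes\<close>

definition list_prod :: "('a, 'b) monoid_scheme \<Rightarrow> 'a list \<Rightarrow> 'a" where
  "list_prod G xs = foldr (\<otimes>\<^bsub>G\<^esub>) xs \<one>\<^bsub>G\<^esub>"

definition word_length :: "(int^2^2) set \<Rightarrow> nat" where
  "word_length g = (LEAST n. \<exists>xs. length xs = n \<and> set xs \<subseteq> {gen_A, gen_B, inv\<^bsub>PSL2Z\<^esub> gen_B} \<and>
     list_prod PSL2Z xs = g)"

definition conj_class :: "('a, 'b) monoid_scheme \<Rightarrow> 'a \<Rightarrow> 'a set" where
  "conj_class G g = {h \<otimes>\<^bsub>G\<^esub> g \<otimes>\<^bsub>G\<^esub> inv\<^bsub>G\<^esub> h | h. h \<in> carrier G}"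

definition class_length :: "(int^2^2) set set \<Rightarrow> nat" where
  "class_length C = (LEAST n. \<exists>h\<in>C. word_length h = n)"


section \<open>Primitive and hyperbolic elements\<close>

definition proper_power :: "('a, 'b) monoid_scheme \<Rightarrow> 'a \<Rightarrow> bool" where
  "proper_power G g \<longleftrightarrow> (\<exists>h\<in>carrier G. \<exists>k::nat. k \<ge> 2 \<and> g = h [^]\<^bsub>G\<^esub> k)"

text \<open>The absolute trace is the same for both representatives \<open>M\<close> and \<open>- M\<close>.\<close>

definition hyperbolic :: "(int^2^2) set \<Rightarrow> bool" where
  "hyperbolic g \<longleftrightarrow> g \<in> carrier PSL2Z \<and> (\<exists>M\<in>g. \<bar>trace M\<bar> > 2)"

definition prim_hyp :: "(int^2^2) set set" where
  "prim_hyp = {p \<in> carrier PSL2Z. hyperbolic p \<and> \<not> proper_power PSL2Z p}"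

definition prim_hyp_products :: "(int^2^2) set set" where
  "prim_hyp_products = {list_prod PSL2Z (map (\<lambda>(p, k). p [^]\<^bsub>PSL2Z\<^esub> k) ps) | ps :: ((int^2^2) set \<times> int) list.
     ps \<noteq> [] \<and> fst ` set ps \<subseteq> prim_hyp}"


section \<open>Ambiguous classes\<close>

definition phi_Amb :: "(int^2^2) set \<Rightarrow> (int^2^2) set" where
  "phi_Amb g = inv\<^bsub>PGL2Z\<^esub> elt_w \<otimes>\<^bsub>PGL2Z\<^esub> inv\<^bsub>PGL2Z\<^esub> g \<otimes>\<^bsub>PGL2Z\<^esub> elt_w"

definition ambiguous_class :: "(int^2^2) set set \<Rightarrow> bool" where
  "ambiguous_class C \<longleftrightarrow>
     (\<exists>p\<in>prim_hyp_products. C = conj_class PSL2Z p \<and> phi_Amb ` C = C)"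

definition primitive_class :: "(int^2^2) set set \<Rightarrow> bool" where
  "primitive_class C \<longleftrightarrow> (\<forall>g\<in>C. \<not> proper_power PSL2Z g)"

definition ambiguous_upto :: "nat \<Rightarrow> (int^2^2) set set set" where
  "ambiguous_upto n = {C. ambiguous_class C \<and> class_length C \<le> n}"

definition primitive_ambiguous_upto :: "nat \<Rightarrow> (int^2^2) set set set" where
  "primitive_ambiguous_upto n = {C \<in> ambiguous_upto n. primitive_class C}"


section \<open>Comparison of growth\<close>

definition growth_equiv :: "(nat \<Rightarrow> real) \<Rightarrow> (nat \<Rightarrow> real) \<Rightarrow> bool" (infix \<open>\<simeq>\<close> 50) where
  "f \<simeq> g \<longleftrightarrow> (\<exists>C1>0. \<exists>C2>0. \<exists>C3>0. \<exists>C4>0. \<exists>t0>0. \<forall>t. real t \<ge> t0 \<longrightarrow>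
     C1 * g t + C3 \<le> f t \<and> f t \<le> C2 * g t + C4)"

end

theory Submission
  imports Defs "HOL-Real_Asymp.Real_Asymp"
begin

text \<open>Up to sign, \<open>A B\<close> and \<open>A B\<^sup>-\<^sup>1\<close> are the elementary matrices \<open>U\<close> and \<open>L\<close>, so apart from the
  classes of torsion elements every conjugacy class is that of a nonempty word in \<open>U, L\<close>, and the
  class determines this word up to rotation. Two words conjugate by \<open>g\<close> are compared by applying
  \<open>g\<close> to high powers of the first: eventually the result is, up to sign, \<open>X\<close> or \<open>A X\<close> for a word
  \<open>X\<close>, which turns the conjugacy into a word equation in the free monoid on \<open>U, L\<close>.
  Since \<open>w U\<^sup>-\<^sup>1 w = U\<close> and \<open>w L\<^sup>-\<^sup>1 w = L\<close>, the involution reverses words. As \<open>U\<close> and \<open>L\<close> are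
  quotients of primitive hyperbolic elements, the ambiguous classes are exactly the cyclic words
  invariant under reversal, up to at most four torsion classes. Such a word of length \<open>k\<close> is
  determined by about half of its letters, which gives the growth rate \<open>2\<^sup>t\<^sup>/\<^sup>2\<close>. A nonprimitive one
  is a power of a reversible word of at most half the length, so these contribute only
  \<open>O(t 2\<^sup>t\<^sup>/\<^sup>4)\<close>.\<close>

section \<open>Rotations, powers and palindromes of words\<close>

definition pow_word :: "nat \<Rightarrow> 'a list \<Rightarrow> 'a list" where
  "pow_word n xs = concat (replicate n xs)"

lemma pow_word_0 [simp]: "pow_word 0 xs = []"
  by (simp add: pow_word_def)

lemma pow_word_Suc [simp]: "pow_word (Suc n) xs = xs @ pow_word n xs"
  by (simp add: pow_word_def)

lemma pow_word_Suc': "pow_word (Suc n) xs = pow_word n xs @ xs"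
  by (induction n) auto

lemma length_pow_word [simp]: "length (pow_word n xs) = n * length xs"
  by (induction n) auto

lemma rev_pow_word: "rev (pow_word n xs) = pow_word n (rev xs)"
proof (induction n)
  case (Suc n)
  then show ?case
    by (metis pow_word_Suc pow_word_Suc' rev_append)
qed simp

lemma append_pow_word_swap: "x # pow_word n (xs @ [x]) = pow_word n (x # xs) @ [x]"
  by (induction n) auto

lemma rotate1_pow_word: "rotate1 (pow_word n xs) = pow_word n (rotate1 xs)"
proof (cases xs)
  case Nil
  then have "pow_word n xs = []"
    by (induction n) auto
  then show ?thesis
    using Nil by simp
next
  case (Cons y ys)
  then show ?thesis
    by (cases n) (use append_pow_word_swap[of y _ ys] in auto)
qed

lemma rotate_pow_word: "rotate i (pow_word n xs) = pow_word n (rotate i xs)"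
  by (induction i) (auto simp: rotate1_pow_word)

lemma pow_word_eq_iff:
  assumes "length xs = length ys" "n > 0"
  shows "pow_word n xs = pow_word n ys \<longleftrightarrow> xs = ys"
  using assms by (cases n) auto

definition rot_equiv :: "'a list \<Rightarrow> 'a list \<Rightarrow> bool" where
  "rot_equiv xs ys \<longleftrightarrow> (\<exists>i. ys = rotate i xs)"

lemma rot_equiv_length: "rot_equiv xs ys \<Longrightarrow> length ys = length xs"
  by (auto simp: rot_equiv_def)

lemma rot_equiv_trans: "rot_equiv xs ys \<Longrightarrow> rot_equiv ys zs \<Longrightarrow> rot_equiv xs zs"
  by (auto simp: rot_equiv_def rotate_rotate)

lemma rotate_mult_length: "rotate (m * length xs) xs = xs"
  by (metis mod_mult_self2_is_0 rotate_conv_mod rotate0 id_apply)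

lemma rot_equiv_sym:
  assumes "rot_equiv xs ys"
  shows "rot_equiv ys xs"
proof -
  obtain i where i: "ys = rotate i xs"
    using assms by (auto simp: rot_equiv_def)
  show ?thesis
  proof (cases "xs = []")
    case False
    then have "i \<le> i * length xs"
      by (simp add: Suc_leI)
    then have "rotate (i * length xs - i) ys = xs"
      using rotate_mult_length[of i xs] by (simp add: i rotate_rotate)
    then show ?thesis
      unfolding rot_equiv_def by metis
  qed (use i in \<open>auto simp: rot_equiv_def\<close>)
qed

lemma rot_equiv_append: "rot_equiv (xs @ ys) (ys @ xs)"
  unfolding rot_equiv_def by (metis rotate_append)

text \<open>If \<open>e'\<close> fits into \<open>x\<close>, it can be stripped from the front of
  \<open>x\<close>, which leaves the same equation for a shorter word. Otherwise
  \<open>e' = x @ u\<close> and \<open>e = u @ x\<close>.\<close>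

lemma conjugate_words_rot_equiv:
  assumes "x @ e = e' @ x" "e' \<noteq> []"
  shows "rot_equiv e e'"
  using assms(1)
proof (induction x rule: length_induct)
  case (1 x)
  from 1(2) obtain u where "x = e' @ u \<and> u @ e = x \<or> x @ u = e' \<and> e = u @ x"
    by (auto simp: append_eq_append_conv2)
  then show ?case
  proof
    assume u: "x = e' @ u \<and> u @ e = x"
    then have "length u < length x" "u @ e = e' @ u"
      using assms(2) by auto
    then show ?thesis
      using 1(1) by blast
  next
    assume "x @ u = e' \<and> e = u @ x"
    then show ?thesis
      using rot_equiv_append[of u x] by simp
  qed
qed

text \<open>The dihedral relation: reversal conjugates a rotation into its inverse.\<close>

lemma rotate_rev_rotate: "rotate j (rev (rotate j e)) = rev e"
proof (induction j arbitrary: e)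
  case (Suc j)
  have *: "rotate1 (rev (rotate1 e)) = rev e" for e :: "'a list"
    by (cases e) auto
  have "rotate (Suc j) (rev (rotate (Suc j) e)) = rotate1 (rotate j (rev (rotate j (rotate1 e))))"
    by (simp add: rotate1_rotate_swap)
  then show ?case
    using Suc * by simp
qed simp

lemma rot_equiv_rev:
  assumes "rot_equiv xs ys"
  shows "rot_equiv (rev xs) (rev ys)"
proof -
  obtain i where "ys = rotate i xs"
    using assms by (auto simp: rot_equiv_def)
  then have "rotate i (rev ys) = rev xs"
    by (simp add: rotate_rev_rotate)
  then show ?thesis
    by (metis rot_equiv_def rot_equiv_sym)
qed

lemma rotate_inj: "rotate i xs = rotate i ys \<longleftrightarrow> xs = ys"
proof (induction i)
  case (Suc i)
  have "inj rotate1"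
    by (rule inj_rotate1)
  then show ?case
    using Suc by (auto dest: injD)
qed simp

section \<open>Words invariant under reversal\<close>

definition palindromes :: "nat \<Rightarrow> 'a list set" where
  "palindromes n = {e. length e = n \<and> rev e = e}"

text \<open>Representatives of the cyclic words of length \<open>n\<close> that are invariant under reversal: the
  reflection axis passes through the cut or through the first letter.\<close>

definition reversible_reps :: "nat \<Rightarrow> 'a list set" where
  "reversible_reps n = palindromes n \<union> {a # p | a p. p \<in> palindromes (n - 1) \<and> n > 0}"

text \<open>After rotating by half of the offset \<open>i\<close>, reversal acts on the rotated word
  as rotation by 0 or 1, according to the parity of \<open>i\<close>.\<close>

lemma exists_reversible_rep:
  assumes "rot_equiv e (rev e)"
  shows "\<exists>r\<in>reversible_reps (length e). rot_equiv e r"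
proof -
  obtain i where i: "rev e = rotate i e"
    using assms by (auto simp: rot_equiv_def)
  define j where "j = i div 2"
  let ?r = "rotate j e"
  have 1: "rotate j (rev ?r) = rotate i e"
    by (simp add: rotate_rev_rotate i)
  have "?r \<in> reversible_reps (length e)"
  proof (cases "even i")
    case True
    then have "rotate i e = rotate j ?r"
      by (auto simp: j_def rotate_rotate simp flip: mult_2)
    then have "rev ?r = ?r"
      using 1 rotate_inj by metis
    then show ?thesis
      by (simp add: reversible_reps_def palindromes_def)
  next
    case False
    then have "i = j + (j + 1)"
      by (auto simp: j_def elim!: oddE)
    then have "rotate i e = rotate j (rotate1 ?r)"
      by (simp add: rotate_rotate flip: rotate_Suc)
    \<comment> \<open>With \<open>?r = a # p\<close> this reads
      \<open>rev p @ [a] = p @ [a]\<close>, so the tail is a palindrome.\<close>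
    then have 2: "rev ?r = rotate1 ?r"
      using 1 rotate_inj by metis
    show ?thesis
    proof (cases ?r)
      case (Cons a p)
      then have "rev p = p" "length e = Suc (length p)"
        using 2 by (auto dest: arg_cong[where f = length])
      then show ?thesis
        using Cons by (simp add: reversible_reps_def palindromes_def)
    qed (simp add: reversible_reps_def palindromes_def)
  qed
  then show ?thesis
    unfolding rot_equiv_def by blast
qed

text \<open>Reversal and rotation of a power act on its base, and a positive power determines its
  base among words of equal length. Hence roots inherit reversibility.\<close>

lemma rot_equiv_rev_root:
  assumes "rot_equiv (pow_word n f) (rev (pow_word n f))" "n > 0"
  shows "rot_equiv f (rev f)"
proof -
  obtain i where "pow_word n (rev f) = pow_word n (rotate i f)"
    using assms by (auto simp: rot_equiv_def rev_pow_word rotate_pow_word)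
  then have "rev f = rotate i f"
    using assms(2) by (subst (asm) pow_word_eq_iff) auto
  then show ?thesis
    unfolding rot_equiv_def by blast
qed

lemma rot_equiv_pow_word: "rot_equiv f g \<Longrightarrow> rot_equiv (pow_word n f) (pow_word n g)"
  by (auto simp: rot_equiv_def rotate_pow_word)

text \<open>By the dihedral relation, the square of a rotation between two palindromes fixes
  \<open>e\<close>. Modulo an odd length 2 is invertible, so the rotation itself fixes
  \<open>e\<close>.\<close>

lemma rot_equiv_odd_palindromes:
  assumes "rot_equiv e e'" "rev e = e" "rev e' = e'" "odd (length e)"
  shows "e' = e"
proof -
  obtain i where i: "e' = rotate i e"
    using assms by (auto simp: rot_equiv_def)
  have "rotate i (rev (rotate i e)) = rotate 0 e"
    by (simp add: rotate_rev_rotate assms)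
  then have 2: "rotate (2 * i) e = e"
    using assms i by (simp add: rotate_rotate mult_2)
  have *: "rotate (m * (2 * i)) e = e" for m
    using 2 by (induction m) (auto simp flip: rotate_rotate simp: algebra_simps)
  \<comment> \<open>\<open>m\<close> is the inverse of 2 modulo \<open>length e\<close>.\<close>
  obtain m where m: "length e + 1 = m * 2"
    using assms(4) by (metis dvd_mult_div_cancel even_plus_one_iff mult.commute)
  have "i * length e + i = m * (2 * i)"
    using m by (metis add_mult_distrib2 mult.commute mult.left_commute mult_1 mult.assoc)
  then have "rotate (i + i * length e) e = e"
    using * by (metis add.commute)
  then have "rotate i e = e"
    by (simp add: rotate_mult_length flip: rotate_rotate)
  then show ?thesis
    using i by simp
qed

section \<open>Counting palindromes and reversible representatives\<close>

lemma finite_bool_lists: "finite {xs :: bool list. length xs = n}"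
  using finite_lists_length_eq[of "UNIV :: bool set" n] by simp

lemma card_bool_lists: "card {xs :: bool list. length xs = n} = 2 ^ n"
  using card_lists_length_eq[of "UNIV :: bool set" n] by simp

lemma finite_palindromes: "finite (palindromes n :: bool list set)"
  by (rule finite_subset[OF _ finite_bool_lists[of n]]) (auto simp: palindromes_def)

text \<open>A palindrome is determined by its first half, rounded up so as to include a middle
  letter.\<close>

lemma card_palindromes_le: "card (palindromes n :: bool list set) \<le> 2 ^ ((n + 1) div 2)"
proof -
  let ?m = "(n + 1) div 2"
  have "inj_on (take ?m) (palindromes n :: bool list set)"
  proof (rule inj_onI)
    fix x y :: "bool list"
    assume xy: "x \<in> palindromes n" "y \<in> palindromes n" "take ?m x = take ?m y"
    have *: "drop (n div 2) z = rev (take ?m z)" if "z \<in> palindromes n" for z :: "bool list"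
    proof -
      have z: "length z = n" "rev z = z"
        using that by (auto simp: palindromes_def)
      have "rev (take ?m z) = drop (n - ?m) (rev z)"
        using z by (simp add: rev_take)
      moreover have "n - ?m = n div 2"
        by linarith
      ultimately show ?thesis
        using z by simp
    qed
    have "take (n div 2) x = take (n div 2) y"
      using xy(3) by (metis add_leE div_le_mono le_add1 min.absorb1 take_take)
    moreover have "drop (n div 2) x = drop (n div 2) y"
      using * xy by metis
    ultimately show "x = y"
      by (metis append_take_drop_id)
  qed
  moreover have "take ?m ` palindromes n \<subseteq> {xs :: bool list. length xs = ?m}"
    by (auto simp: palindromes_def)
  ultimately have "card (palindromes n :: bool list set) \<le> card {xs :: bool list. length xs = ?m}"
    using finite_bool_lists card_inj_on_le by blast
  then show ?thesis
    by (simp add: card_bool_lists)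
qed

text \<open>An arbitrary word of length \<open>m + 1\<close> is mirrored at its last letter. The odd
  total length is what \<open>rot_equiv_odd_palindromes\<close> asks for.\<close>

lemma card_odd_palindromes_ge: "2 ^ Suc m \<le> card (palindromes (2 * m + 1) :: bool list set)"
proof -
  let ?f = "\<lambda>xs :: bool list. xs @ rev (butlast xs)"
  have "inj_on ?f {xs. length xs = Suc m}"
    by (rule inj_onI) (auto simp: append_eq_append_conv)
  moreover have "?f ` {xs. length xs = Suc m} \<subseteq> palindromes (2 * m + 1)"
  proof clarify
    fix xs :: "bool list"
    assume xs: "length xs = Suc m"
    then have "butlast xs @ [last xs] = xs"
      by (metis append_butlast_last_id length_0_conv nat.simps(3))
    then obtain y a where "xs = y @ [a]"
      by metis
    then show "?f xs \<in> palindromes (2 * m + 1)"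
      using xs by (auto simp: palindromes_def)
  qed
  ultimately have "card {xs :: bool list. length xs = Suc m}
      \<le> card (palindromes (2 * m + 1) :: bool list set)"
    using finite_palindromes card_inj_on_le by blast
  then show ?thesis
    by (simp add: card_bool_lists)
qed

lemma reversible_reps_alt:
  "reversible_reps n = palindromes n \<union>
     (if n > 0 then (\<lambda>(a, p). a # p) ` (UNIV \<times> palindromes (n - 1)) else {})"
  by (auto simp: reversible_reps_def)

lemma finite_reversible_reps: "finite (reversible_reps n :: bool list set)"
  by (simp add: reversible_reps_alt finite_palindromes)

text \<open>Each of the two kinds contributes at most \<open>2 * 2 ^ (n div 2)\<close>: the factor 2
  comes from rounding up for palindromes and from the free first letter for the others.\<close>

lemma card_reversible_reps: "card (reversible_reps n :: bool list set) \<le> 4 * 2 ^ (n div 2)"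
proof -
  have 1: "card (palindromes n :: bool list set) \<le> 2 * 2 ^ (n div 2)"
  proof -
    have "(2::nat) ^ ((n + 1) div 2) \<le> 2 ^ Suc (n div 2)"
      by (rule power_increasing) auto
    then show ?thesis
      using card_palindromes_le[of n] by simp
  qed
  have 2: "card ((\<lambda>(a, p). a # p) ` (UNIV \<times> palindromes (n - 1)) :: bool list set) \<le> 2 * 2 ^ (n div 2)"
    if "n > 0"
  proof -
    have "card ((\<lambda>(a, p). a # p) ` (UNIV \<times> palindromes (n - 1)) :: bool list set)
        \<le> card ((UNIV :: bool set) \<times> (palindromes (n - 1) :: bool list set))"
      by (intro card_image_le finite_cartesian_product finite_palindromes) auto
    also have "\<dots> = 2 * card (palindromes (n - 1) :: bool list set)"
      by (simp add: card_cartesian_product)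
    also have "\<dots> \<le> 2 * 2 ^ (n div 2)"
      using card_palindromes_le[of "n - 1"] that by simp
    finally show ?thesis .
  qed
  show ?thesis
  proof (cases "n > 0")
    case True
    then have "card (reversible_reps n :: bool list set) \<le> card (palindromes n :: bool list set) +
        card ((\<lambda>(a, p). a # p) ` (UNIV \<times> palindromes (n - 1)) :: bool list set)"
      unfolding reversible_reps_alt by (simp add: card_Un_le)
    then show ?thesis
      using 1 2 True by simp
  qed (use 1 in \<open>simp add: reversible_reps_alt\<close>)
qed

definition reversible_reps_upto :: "nat \<Rightarrow> 'a list set" where
  "reversible_reps_upto n = (\<Union>k\<le>n. reversible_reps k)"

lemma finite_reversible_reps_upto: "finite (reversible_reps_upto n :: bool list set)"
  by (simp add: reversible_reps_upto_def finite_reversible_reps)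

text \<open>In steps of two: the two new terms add at most \<open>4 * 2 ^ (n div 2)\<close>, while
  the bound doubles.\<close>

lemma sum_power_half_le: "(\<Sum>k\<le>n. 2 ^ (k div 2)) \<le> (4 * 2 ^ (n div 2) :: nat)"
proof (induction n rule: induct_nat_012)
  case (ge2 n)
  have "(2::nat) ^ (Suc n div 2) \<le> 2 ^ Suc (n div 2)"
    by (rule power_increasing) auto
  then show ?case
    using ge2 by simp
qed (auto simp: numeral_eq_Suc)

lemma card_reversible_reps_upto:
  "card (reversible_reps_upto n :: bool list set) \<le> 16 * 2 ^ (n div 2)"
proof -
  have "card (reversible_reps_upto n :: bool list set)
      \<le> (\<Sum>k\<le>n. card (reversible_reps k :: bool list set))"
    unfolding reversible_reps_upto_def by (rule card_UN_le) auto
  also have "\<dots> \<le> (\<Sum>k\<le>n. 4 * 2 ^ (k div 2))"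
    by (intro sum_mono card_reversible_reps)
  also have "\<dots> \<le> 16 * 2 ^ (n div 2)"
    using sum_power_half_le[of n] by (simp flip: sum_distrib_left)
  finally show ?thesis .
qed

section \<open>The free monoid of nonnegative matrices\<close>

definition mk :: "int \<Rightarrow> int \<Rightarrow> int \<Rightarrow> int \<Rightarrow> int^2^2" where
  "mk a b c d = vector [vector [a, b], vector [c, d]]"

lemma mk_nth [simp]:
  "mk a b c d $ 1 $ 1 = a" "mk a b c d $ 1 $ 2 = b" "mk a b c d $ 2 $ 1 = c" "mk a b c d $ 2 $ 2 = d"
  by (simp_all add: mk_def)

lemma mat2_eq_iff:
  fixes M N :: "int^2^2"
  shows "M = N \<longleftrightarrow> M$1$1 = N$1$1 \<and> M$1$2 = N$1$2 \<and> M$2$1 = N$2$1 \<and> M$2$2 = N$2$2"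
  by (auto simp: vec_eq_iff forall_2)

lemma mk_cases: obtains a b c d where "M = mk a b c d"
  by (metis mat2_eq_iff mk_nth)

lemma mk_mult [simp]:
  "mk a b c d ** mk a' b' c' d' = mk (a*a' + b*c') (a*b' + b*d') (c*a' + d*c') (c*b' + d*d')"
  by (simp add: mat2_eq_iff matrix_matrix_mult_def sum_2)

lemma mk_uminus [simp]: "- mk a b c d = mk (-a) (-b) (-c) (-d)"
  by (simp add: mat2_eq_iff)

lemma mk_eq_iff [simp]: "mk a b c d = mk a' b' c' d' \<longleftrightarrow> a = a' \<and> b = b' \<and> c = c' \<and> d = d'"
  by (simp add: mat2_eq_iff)

lemma mat_1_mk: "mat 1 = mk 1 0 0 1"
  by (simp add: mat2_eq_iff mat_def)

lemma det_mk [simp]: "det (mk a b c d) = a * d - b * c"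
  by (simp add: det_2)

lemma trace_mk [simp]: "trace (mk a b c d) = a + d"
  by (simp add: trace_def sum_2)

lemma uminus_mult [simp]:
  fixes M N :: "int^2^2"
  shows "(- M) ** N = - (M ** N)" "M ** (- N) = - (M ** N)"
  by (cases M rule: mk_cases; cases N rule: mk_cases; simp)+

text \<open>The adjugate, which on determinant 1 is the inverse in a form that can be computed
  with.\<close>

definition adj :: "int^2^2 \<Rightarrow> int^2^2" where
  "adj M = mk (M$2$2) (- M$1$2) (- M$2$1) (M$1$1)"

lemma adj_mk [simp]: "adj (mk a b c d) = mk d (-b) (-c) a"
  by (simp add: adj_def)

lemma adj_mult_self: "det M = 1 \<Longrightarrow> adj M ** M = mat 1" "det M = 1 \<Longrightarrow> M ** adj M = mat 1"
  by (cases M rule: mk_cases; simp add: mat_1_mk algebra_simps)+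

lemma det_adj [simp]: "det (adj M) = det M"
  by (cases M rule: mk_cases) simp

lemma adj_mult: "adj (M ** N) = adj N ** adj M"
  by (cases M rule: mk_cases; cases N rule: mk_cases) (simp add: algebra_simps)

abbreviation "mA \<equiv> mk 0 (-1) 1 0"
abbreviation "mB \<equiv> mk 0 (-1) 1 1"
abbreviation "mU \<equiv> mk 1 1 0 1"
abbreviation "mL \<equiv> mk 1 0 1 1"

definition letter :: "bool \<Rightarrow> int^2^2" where
  "letter x = (if x then mU else mL)"

fun Wm :: "bool list \<Rightarrow> int^2^2" where
  "Wm [] = mat 1"
| "Wm (x # xs) = letter x ** Wm xs"

lemma Wm_append: "Wm (xs @ ys) = Wm xs ** Wm ys"
  by (induction xs) (auto simp: matrix_mul_assoc)

lemma det_letter [simp]: "det (letter x) = 1"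
  by (simp add: letter_def)

lemma det_Wm [simp]: "det (Wm xs) = 1"
  by (induction xs) (auto simp: det_mul)

lemma Wm_nonneg: "0 \<le> Wm xs $ i $ j"
proof -
  have "\<exists>a b c d. Wm xs = mk a b c d \<and> 0 \<le> a \<and> 0 \<le> b \<and> 0 \<le> c \<and> 0 \<le> d"
    by (induction xs) (auto simp: mat_1_mk letter_def)
  moreover have "(i = 1 \<or> i = 2) \<and> (j = 1 \<or> j = 2)"
    using exhaust_2 by auto
  ultimately show ?thesis
    by auto
qed

lemma Wm_cases:
  obtains a b c d where "Wm xs = mk a b c d" "0 \<le> a" "0 \<le> b" "0 \<le> c" "0 \<le> d" "a * d - b * c = 1"
proof -
  obtain a b c d where *: "Wm xs = mk a b c d"
    by (rule mk_cases)
  show ?thesis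
    using that[OF *] Wm_nonneg[of xs 1 1] Wm_nonneg[of xs 1 2] Wm_nonneg[of xs 2 1]
      Wm_nonneg[of xs 2 2] det_Wm[of xs] * by simp
qed

text \<open>Both matrices are nonnegative, so they would have to vanish, against determinant 1.
  Hence the sign ambiguity in \<open>PSL2Z\<close> never identifies two words.\<close>

lemma Wm_neq_uminus: "Wm xs \<noteq> - Wm ys"
  by (cases xs rule: Wm_cases; cases ys rule: Wm_cases) auto

lemma Wm_Nil_neq_Cons: "Wm (x # xs) \<noteq> mat 1"
  by (cases xs rule: Wm_cases) (auto simp: letter_def mat_1_mk)

text \<open>The first letter is visible in the product: after \<open>U\<close> the top row dominates
  the bottom row, after \<open>L\<close> the bottom row dominates. Both at once would force a zero
  row. Peeling off letters then shows that the monoid on \<open>U\<close> and \<open>L\<close> is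
  free.\<close>

lemma letter_mult_Wm_inject:
  assumes "letter x ** Wm xs = letter y ** Wm ys"
  shows "x = y \<and> Wm xs = Wm ys"
proof (cases xs rule: Wm_cases)
  case (1 a b c d)
  note 1 = this
  show ?thesis
  proof (cases ys rule: Wm_cases)
    case (1 a' b' c' d')
    have "\<not> (a = 0 \<and> b = 0)" "\<not> (a' = 0 \<and> b' = 0)"
      using 1 \<open>a * d - b * c = 1\<close> by auto
    then show ?thesis
      using 1 \<open>Wm xs = _\<close> assms \<open>0 \<le> a\<close> \<open>0 \<le> b\<close> \<open>0 \<le> c\<close> \<open>0 \<le> d\<close>
      by (cases x; cases y) (auto simp: letter_def)
  qed
qed

lemma Wm_inject: "Wm xs = Wm ys \<longleftrightarrow> xs = ys"
proof
  assume "Wm xs = Wm ys"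
  then show "xs = ys"
  proof (induction xs arbitrary: ys)
    case Nil
    then show ?case
      by (cases ys) (use Wm_Nil_neq_Cons in \<open>fastforce+\<close>)
  next
    case (Cons x xs)
    show ?case
    proof (cases ys)
      case Nil
      then show ?thesis
        using Cons.prems Wm_Nil_neq_Cons[of x xs] by simp
    next
      case (Cons y ys')
      then show ?thesis
        using Cons.prems Cons.IH letter_mult_Wm_inject[of x xs y ys'] by simp
    qed
  qed
qed simp

text \<open>The word \<open>rev (map Not e)\<close> is the one of the transposed matrix.\<close>

lemma Wm_transpose_symplectic: "Wm (rev (map Not e)) ** mA ** Wm e = mA"
proof (induction e)
  case (Cons x xs)
  have *: "letter (\<not> x) ** mA ** letter x = mA"
    by (simp add: letter_def)
  have "Wm (rev (map Not (x # xs))) ** mA ** Wm (x # xs) =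
      Wm (rev (map Not xs)) ** (letter (\<not> x) ** mA ** letter x) ** Wm xs"
    by (simp add: Wm_append matrix_mul_assoc matrix_mul_rid del: mk_mult)
  then show ?case
    using Cons * by (simp add: matrix_mul_assoc)
qed (simp add: mat_1_mk)

section \<open>Conjugacy of words\<close>

text \<open>Left multiplication by \<open>A\<close> and \<open>U\<close> is the induction that suits
  both \<open>conj_absorb\<close> and spelling elements in generators; closure under sign absorbs
  the passage to \<open>PSL2Z\<close>.\<close>

inductive_set generated :: "(int^2^2) set" where
  one: "mat 1 \<in> generated"
| A: "M \<in> generated \<Longrightarrow> mA ** M \<in> generated"
| U: "M \<in> generated \<Longrightarrow> mU ** M \<in> generated"
| uminus: "M \<in> generated \<Longrightarrow> - M \<in> generated"

lemma generated_mk_U: "mk a b c d \<in> generated \<Longrightarrow> mk (a + k * c) (b + k * d) c d \<in> generated"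
proof -
  assume 0: "mk a b c d \<in> generated"
  have up: "mk (a + c) (b + d) c d \<in> generated" if "mk a b c d \<in> generated" for a b c d
    using generated.U[OF that] by simp
  \<comment> \<open>From \<open>(A U)^3 = -1\<close> it follows that
    \<open>U^-1 = - A U A U A\<close>.\<close>
  have down: "mk (a - c) (b - d) c d \<in> generated" if "mk a b c d \<in> generated" for a b c d
    using generated.uminus[OF generated.A[OF generated.U[OF generated.A[OF generated.U[OF
      generated.A[OF that]]]]]] by simp
  show ?thesis
  proof (induction k rule: int_induct[where k = 0])
    case base
    then show ?case using 0 by simp
  next
    case (step1 i)
    then show ?case using up[OF step1(2)] by (simp add: algebra_simps)
  next
    case (step2 i)
    then show ?case using down[OF step2(2)] by (simp add: algebra_simps)
  qed
qed

text \<open>The Euclidean algorithm on the first column: powers of \<open>U\<close> reduce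
  \<open>a\<close> modulo \<open>c\<close>, and \<open>A\<close> exchanges the rows up to
  sign.\<close>

lemma det_1_generated:
  assumes "det M = 1"
  shows "M \<in> generated"
proof -
  have "mk a b c d \<in> generated" if "a * d - b * c = 1" for a b c d
    using that
  proof (induction "nat \<bar>c\<bar>" arbitrary: a b c d rule: less_induct)
    case less
    show ?case
    proof (cases "c = 0")
      case True
      then have "a * d = 1"
        using less by simp
      then consider "a = 1" "d = 1" | "a = -1" "d = -1"
        by (auto simp: zmult_eq_1_iff)
      then show ?thesis
      proof cases
        case 1
        then show ?thesis
          using generated_mk_U[OF generated.one[unfolded mat_1_mk], of b] True by simp
      next
        case 2
        then show ?thesis
          using generated.uminus[OF generated_mk_U[OF generated.one[unfolded mat_1_mk], of "-b"]] True
          by simp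
      qed
    next
      case False
      obtain q r where r: "a = q * c + r" "\<bar>r\<bar> < \<bar>c\<bar>"
        using abs_mod_less[OF False, of a] by (metis div_mult_mod_eq)
      then have "nat \<bar>- r\<bar> < nat \<bar>c\<bar>"
        by simp
      moreover have "c * (- (b - q * d)) - d * (- r) = 1"
        using r less.prems by (simp add: algebra_simps)
      ultimately have "mk c d (- r) (- (b - q * d)) \<in> generated"
        by (intro less.hyps)
      then have "mA ** mk c d (- r) (- (b - q * d)) \<in> generated"
        by (rule generated.A)
      then have "mk r (b - q * d) c d \<in> generated"
        by simp
      from generated_mk_U[OF this, of q] show ?thesis
        using r by (simp add: algebra_simps)
    qed
  qed
  then show ?thesis
    using assms by (cases M rule: mk_cases) auto
qed

text \<open>The identities \<open>U A U = L\<close> and \<open>U A L = A\<close> absorb a new factor \<open>U\<close> as soon as one more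
  letter is available on the right.\<close>

lemma conj_absorb:
  assumes "g \<in> generated" "e \<noteq> []"
  shows "\<exists>n x. g ** Wm (pow_word n e) \<in> {Wm x, - Wm x, mA ** Wm x, - (mA ** Wm x)}"
  using assms(1)
proof induction
  case one
  then show ?case
    by (metis insertI1 matrix_mul_lid)
next
  case (A M)
  then obtain n x where "M ** Wm (pow_word n e) \<in> {Wm x, - Wm x, mA ** Wm x, - (mA ** Wm x)}"
    by blast
  moreover have "mA ** (mA ** N) = - N" for N :: "int^2^2"
    by (cases N rule: mk_cases) simp
  ultimately have "mA ** M ** Wm (pow_word n e) \<in> {Wm x, - Wm x, mA ** Wm x, - (mA ** Wm x)}"
    by (auto simp flip: matrix_mul_assoc)
  then show ?case
    by blast
next
  case (uminus M)
  then obtain n x where "M ** Wm (pow_word n e) \<in> {Wm x, - Wm x, mA ** Wm x, - (mA ** Wm x)}"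
    by blast
  then have "- M ** Wm (pow_word n e) \<in> {Wm x, - Wm x, mA ** Wm x, - (mA ** Wm x)}"
    by auto
  then show ?case
    by blast
next
  case (U M)
  then obtain n x where nx: "M ** Wm (pow_word n e) \<in> {Wm x, - Wm x, mA ** Wm x, - (mA ** Wm x)}"
    by blast
  have "M ** Wm (pow_word (Suc n) e) = M ** Wm (pow_word n e) ** Wm e"
    by (simp only: pow_word_Suc' Wm_append matrix_mul_assoc)
  then have "M ** Wm (pow_word (Suc n) e) \<in>
      {Wm (x @ e), - Wm (x @ e), mA ** Wm (x @ e), - (mA ** Wm (x @ e))}"
    using nx by (auto simp: Wm_append matrix_mul_assoc)
  moreover obtain y ys where y: "x @ e = y # ys"
    using assms(2) by (cases "x @ e") auto
  moreover have "mU ** N = letter True ** N" for N :: "int^2^2"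
    by (simp add: letter_def)
  moreover have "mU ** (mA ** (letter True ** N)) = letter False ** N"
      "mU ** (mA ** (letter False ** N)) = mA ** N" for N :: "int^2^2"
    by (cases N rule: mk_cases; simp add: letter_def)+
  ultimately have "mU ** M ** Wm (pow_word (Suc n) e) \<in>
      {Wm (True # y # ys), - Wm (True # y # ys), Wm (False # ys), - Wm (False # ys),
       mA ** Wm ys, - (mA ** Wm ys)}"
    by (cases y) (auto simp flip: matrix_mul_assoc)
  then show ?case
    by blast
qed

lemma conjugate_Wm_rot_equiv:
  assumes "det g = 1" "e \<noteq> []" "e' \<noteq> []"
    and conj: "g ** Wm e = Wm e' ** g \<or> g ** Wm e = - (Wm e' ** g)"
  shows "rot_equiv e e'"
proof -
  obtain n x where nx: "g ** Wm (pow_word n e) \<in> {Wm x, - Wm x, mA ** Wm x, - (mA ** Wm x)}"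
    using conj_absorb det_1_generated assms by blast
  define X where "X = g ** Wm (pow_word n e)"
  \<comment> \<open>\<open>X\<close> inherits the conjugation equation of \<open>g\<close>, because
    \<open>e\<close> commutes with its powers.\<close>
  have "X ** Wm e = g ** Wm e ** Wm (pow_word n e)"
    unfolding X_def by (metis matrix_mul_assoc Wm_append pow_word_Suc pow_word_Suc')
  then have X: "X ** Wm e = Wm e' ** X \<or> X ** Wm e = - (Wm e' ** X)"
    using conj by (auto simp: X_def matrix_mul_assoc)
  have "X = Wm x \<or> X = - Wm x \<or> X = mA ** Wm x \<or> X = - (mA ** Wm x)"
    using nx by (simp add: X_def)
  then consider "X = Wm x \<or> X = - Wm x" | "X = mA ** Wm x \<or> X = - (mA ** Wm x)"
    by blast
  moreover have neg: "P = - Q" if "- P = Q" for P Q :: "int^2^2"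
    using that by auto
  ultimately show ?thesis
  proof cases
    case 1
    \<comment> \<open>Both sides are now positive words, so freeness removes the matrices and the
      sign.\<close>
    then have "Wm (x @ e) = Wm (e' @ x) \<or> Wm (x @ e) = - Wm (e' @ x)"
      using X by (auto simp: Wm_append dest: neg)
    then have "x @ e = e' @ x"
      using Wm_neq_uminus Wm_inject by blast
    then show ?thesis
      using assms by (intro conjugate_words_rot_equiv)
  next
    case 2
    then have "mA ** Wm (x @ e) = Wm e' ** mA ** Wm x \<or> mA ** Wm (x @ e) = - (Wm e' ** mA ** Wm x)"
      using X by (auto simp: Wm_append matrix_mul_assoc dest: neg)
    \<comment> \<open>Multiplying by \<open>T\<close> turns \<open>Wm e'\<close> into
      \<open>A\<close> by the transpose identity, so that only positive words remain, with the
      transpose of \<open>e'\<close> now on the other side.\<close>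
    moreover define T where "T = Wm (rev (map Not e')) ** mA"
    ultimately have "T ** (mA ** Wm (x @ e)) = T ** (Wm e' ** mA ** Wm x) \<or>
        T ** (mA ** Wm (x @ e)) = - (T ** (Wm e' ** mA ** Wm x))"
      by auto
    then have "T ** (mA ** Wm (x @ e)) = T ** Wm e' ** mA ** Wm x \<or>
        T ** (mA ** Wm (x @ e)) = - (T ** Wm e' ** mA ** Wm x)"
      by (simp only: matrix_mul_assoc)
    moreover have "T ** Wm e' = mA"
      using Wm_transpose_symplectic by (simp add: T_def)
    moreover have "mA ** mA = - mat 1"
      by (simp add: mat_1_mk)
    moreover have "T ** (mA ** Wm (x @ e)) = - Wm (rev (map Not e') @ x @ e)"
    proof -
      have "T ** (mA ** Wm (x @ e)) = Wm (rev (map Not e')) ** (mA ** mA) ** Wm (x @ e)"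
        by (simp only: T_def matrix_mul_assoc)
      then show ?thesis
        by (simp only: \<open>mA ** mA = - mat 1\<close>) (simp add: Wm_append)
    qed
    ultimately have "Wm (rev (map Not e') @ x @ e) = Wm x \<or> Wm (rev (map Not e') @ x @ e) = - Wm x"
      by (auto dest: neg)
    then have "rev (map Not e') @ x @ e = x"
      using Wm_neq_uminus Wm_inject by blast
    \<comment> \<open>\<open>x\<close> would be longer than itself, so this case cannot
      occur.\<close>
    then have "length (rev (map Not e') @ x @ e) = length x"
      by simp
    then show ?thesis
      using assms by simp
  qed
qed

section \<open>Conjugacy classes in a group generated by elements of order 2 and 3\<close>

lemma list_prod_simps [simp]:
  "list_prod G [] = \<one>\<^bsub>G\<^esub>" "list_prod G (x # xs) = x \<otimes>\<^bsub>G\<^esub> list_prod G xs"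
  by (simp_all add: list_prod_def)

context group
begin

lemma list_prod_closed [simp]: "set xs \<subseteq> carrier G \<Longrightarrow> list_prod G xs \<in> carrier G"
  by (induction xs) auto

lemma conj_class_self: "g \<in> carrier G \<Longrightarrow> g \<in> conj_class G g"
  unfolding conj_class_def by (intro CollectI exI[of _ \<one>]) simp

lemma conj_class_subset: "g \<in> carrier G \<Longrightarrow> conj_class G g \<subseteq> carrier G"
  by (auto simp: conj_class_def)

lemma conj_class_conj_subset:
  assumes "g \<in> carrier G" "k \<in> carrier G"
  shows "conj_class G (k \<otimes> g \<otimes> inv k) \<subseteq> conj_class G g"
proof
  fix x
  assume "x \<in> conj_class G (k \<otimes> g \<otimes> inv k)"
  then obtain h where "h \<in> carrier G" "x = h \<otimes> (k \<otimes> g \<otimes> inv k) \<otimes> inv h"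
    by (auto simp: conj_class_def)
  then have "h \<otimes> k \<in> carrier G" "x = (h \<otimes> k) \<otimes> g \<otimes> inv (h \<otimes> k)"
    using assms by (simp_all add: inv_mult_group m_assoc)
  then show "x \<in> conj_class G g"
    unfolding conj_class_def by blast
qed

lemma conj_class_conj:
  assumes "g \<in> carrier G" "k \<in> carrier G"
  shows "conj_class G (k \<otimes> g \<otimes> inv k) = conj_class G g"
proof
  have "inv k \<otimes> (k \<otimes> g \<otimes> inv k) \<otimes> inv (inv k) = g"
    using assms by (simp add: m_assoc inv_solve_left')
  then show "conj_class G g \<subseteq> conj_class G (k \<otimes> g \<otimes> inv k)"
    using conj_class_conj_subset[of "k \<otimes> g \<otimes> inv k" "inv k"] assms by simp
qed (use conj_class_conj_subset assms in blast)

lemma conj_class_eqI: "h \<in> conj_class G g \<Longrightarrow> g \<in> carrier G \<Longrightarrow> conj_class G h = conj_class G g"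
  by (auto simp: conj_class_def[of G g] conj_class_conj)

lemma conj_class_eqD:
  assumes "conj_class G g = conj_class G h" "g \<in> carrier G" "h \<in> carrier G"
  obtains k where "k \<in> carrier G" "g = k \<otimes> h \<otimes> inv k"
proof -
  have "g \<in> conj_class G h"
    using conj_class_self assms by metis
  then show ?thesis
    using that by (auto simp: conj_class_def)
qed

lemma conj_class_commute:
  assumes "x \<in> carrier G" "y \<in> carrier G"
  shows "conj_class G (x \<otimes> y) = conj_class G (y \<otimes> x)"
proof -
  have "x \<otimes> y = x \<otimes> (y \<otimes> x) \<otimes> inv x"
    using assms by (simp add: m_assoc)
  then show ?thesis
    using conj_class_conj[of "y \<otimes> x" x] assms by simp
qed

lemma conj_nat_pow:
  assumes "x \<in> carrier G" "k \<in> carrier G"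
  shows "(k \<otimes> x \<otimes> inv k) [^] (n::nat) = k \<otimes> x [^] n \<otimes> inv k"
proof (induction n)
  case (Suc n)
  have "inv k \<otimes> (k \<otimes> y) = y" if "y \<in> carrier G" for y
    using that assms by (simp flip: m_assoc)
  then show ?case
    using Suc assms by (simp add: m_assoc)
qed (use assms in simp)

lemma conj_class_nat_pow:
  assumes "conj_class G g = conj_class G h" "g \<in> carrier G" "h \<in> carrier G"
  shows "conj_class G (g [^] (n::nat)) = conj_class G (h [^] n)"
  using assms by (elim conj_class_eqD) (auto simp: conj_nat_pow conj_class_conj)

lemma conj_class_one: "conj_class G g = conj_class G \<one> \<Longrightarrow> g \<in> carrier G \<Longrightarrow> g = \<one>"
  by (elim conj_class_eqD) auto

end

text \<open>The relations alone give the existence of normal forms with length bounds. Uniqueness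
  enters later, through the freeness of the matrices.\<close>

locale order_2_3 = group +
  fixes a b
  assumes a [simp]: "a \<in> carrier G" and b [simp]: "b \<in> carrier G"
    and aa [simp]: "a \<otimes> a = \<one>" and bbb: "b \<otimes> (b \<otimes> b) = \<one>"
begin

definition syl :: "bool \<Rightarrow> 'a" where
  "syl x = (if x then b else inv b)"

definition wd :: "bool list \<Rightarrow> 'a" where
  "wd e = list_prod G (map (\<lambda>x. a \<otimes> syl x) e)"

definition pre :: "bool option \<Rightarrow> 'a" where
  "pre p = (case p of None \<Rightarrow> \<one> | Some x \<Rightarrow> syl x)"

definition suf :: "bool \<Rightarrow> 'a" where
  "suf q = (if q then a else \<one>)"

text \<open>Alternating products of \<open>a\<close> and \<open>b\<close>, \<open>inv b\<close>:
  \<open>p\<close> and \<open>q\<close> record an unpaired syllable at the start and an unpaired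
  \<open>a\<close> at the end.\<close>

definition nf :: "bool option \<Rightarrow> bool list \<Rightarrow> bool \<Rightarrow> 'a" where
  "nf p e q = pre p \<otimes> (wd e \<otimes> suf q)"

text \<open>The number of generators in the normal form when it is written out.\<close>

definition cost :: "bool option \<Rightarrow> bool list \<Rightarrow> bool \<Rightarrow> nat" where
  "cost p e q = of_bool (p \<noteq> None) + 2 * length e + of_bool q"

lemma syl_closed [simp]: "syl x \<in> carrier G"
  by (simp add: syl_def)

lemma wd_closed [simp]: "wd e \<in> carrier G"
  by (auto simp: wd_def intro!: list_prod_closed)

lemma pre_closed [simp]: "pre p \<in> carrier G"
  by (auto simp: pre_def split: option.split)

lemma suf_closed [simp]: "suf q \<in> carrier G"
  by (simp add: suf_def)

lemma nf_closed [simp]: "nf p e q \<in> carrier G"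
  by (simp add: nf_def)

lemma wd_simps [simp]: "wd [] = \<one>" "wd (x # e) = a \<otimes> (syl x \<otimes> wd e)"
  using wd_closed[of e] by (simp_all add: wd_def m_assoc)

lemma wd_append: "wd (e @ f) = wd e \<otimes> wd f"
  by (induction e) (simp_all add: m_assoc)

lemma aa_assoc [simp]: "x \<in> carrier G \<Longrightarrow> a \<otimes> (a \<otimes> x) = x"
  by (simp flip: m_assoc)

lemma syl_mult: "syl x \<otimes> syl y = pre (if x = y then Some (\<not> x) else None)"
proof -
  have "inv b = b \<otimes> b"
    using bbb by (intro inv_equality) (simp_all add: m_assoc)
  moreover have "b \<otimes> b \<otimes> (b \<otimes> b) = b"
    using bbb by (simp add: m_assoc)
  ultimately show ?thesis
    using bbb by (auto simp: syl_def pre_def m_assoc)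
qed

lemma syl_mult_assoc:
  "z \<in> carrier G \<Longrightarrow> syl x \<otimes> (syl y \<otimes> z) = pre (if x = y then Some (\<not> x) else None) \<otimes> z"
  by (simp add: syl_mult flip: m_assoc)

text \<open>Generators are prepended one at a time; each can be absorbed into the normal form at a
  cost of at most 1.\<close>

lemma list_prod_normal_form:
  assumes "set xs \<subseteq> {a, b, inv b}"
  shows "\<exists>p e q. list_prod G xs = nf p e q \<and> cost p e q \<le> length xs"
  using assms
proof (induction xs)
  case Nil
  have "list_prod G [] = nf None [] False" "cost None [] False = 0"
    by (simp_all add: nf_def pre_def suf_def cost_def)
  then show ?case
    by force
next
  case (Cons x xs)
  then obtain p e q where IH: "list_prod G xs = nf p e q" "cost p e q \<le> length xs"
    by auto
  have "\<exists>p' e' q'. x \<otimes> nf p e q = nf p' e' q' \<and> cost p' e' q' \<le> Suc (cost p e q)"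
  proof (cases "x = a")
    case True
    show ?thesis
    proof (cases p)
      case None
      show ?thesis
      proof (cases e)
        case Nil
        then show ?thesis
          using True None
          by (intro exI[of _ None] exI[of _ "[]"] exI[of _ "\<not> q"])
            (simp add: nf_def pre_def suf_def cost_def)
      next
        \<comment> \<open>The new \<open>a\<close> cancels the first \<open>a\<close>, whose
          syllable becomes the unpaired prefix.\<close>
        case (Cons f e')
        then show ?thesis
          using True None
          by (intro exI[of _ "Some f"] exI[of _ e'] exI[of _ q])
            (simp add: nf_def pre_def cost_def m_assoc)
      qed
    next
      case (Some y)
      then show ?thesis
        using True
        by (intro exI[of _ None] exI[of _ "y # e"] exI[of _ q])
          (simp add: nf_def pre_def cost_def m_assoc)
    qed
  next
    case False
    then have "x = syl True \<or> x = syl False"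
      using Cons.prems by (auto simp: syl_def)
    then obtain y where y: "x = syl y"
      by blast
    show ?thesis
    proof (cases p)
      case None
      then show ?thesis
        using y by (intro exI[of _ "Some y"] exI[of _ e] exI[of _ q])
          (simp add: nf_def pre_def cost_def)
    next
      \<comment> \<open>Two adjacent powers of \<open>b\<close> merge into one syllable or cancel,
        as \<open>b\<close> has order dividing 3.\<close>
      case (Some z)
      have "pre p = syl z"
        using Some by (simp add: pre_def)
      then show ?thesis
        using y Some
        by (intro exI[of _ "if y = z then Some (\<not> y) else None"] exI[of _ e] exI[of _ q])
          (simp add: nf_def cost_def syl_mult_assoc)
    qed
  qed
  then obtain p' e' q' where "x \<otimes> nf p e q = nf p' e' q'" "cost p' e' q' \<le> Suc (cost p e q)"
    by blast
  then show ?case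
    using IH by (intro exI[of _ p'] exI[of _ e'] exI[of _ q']) auto
qed

section \<open>Torsion representatives and cyclic reduction\<close>

definition torsion_reps :: "'a set" where
  "torsion_reps = {\<one>, a, b, inv b}"

text \<open>Cyclic reduction: conjugation moves a factor from one end to the other, where it
  completes a pair, merges or cancels. The cost never grows, and \<open>e\<close> shortens whenever
  the reduction has to continue.\<close>

lemma conj_class_nf:
  "\<exists>h. conj_class G (nf p e q) = conj_class G h \<and>
     (h \<in> torsion_reps \<or> (\<exists>f. f \<noteq> [] \<and> 2 * length f \<le> cost p e q \<and> h = wd f))"
proof (induction "length e" arbitrary: p e q rule: less_induct)
  case less
  have reduce: ?case if step: "conj_class G (nf p e q) = conj_class G (nf p' e' q')"
      "cost p' e' q' \<le> cost p e q" "length e' < length e" for p' e' q'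
  proof -
    obtain h where h: "conj_class G (nf p' e' q') = conj_class G h"
      "h \<in> torsion_reps \<or> (\<exists>f. f \<noteq> [] \<and> 2 * length f \<le> cost p' e' q' \<and> h = wd f)"
      using less step(3) by blast
    then have "h \<in> torsion_reps \<or> (\<exists>f. f \<noteq> [] \<and> 2 * length f \<le> cost p e q \<and> h = wd f)"
      using step(2) order.trans by blast
    then show ?thesis
      using h(1) step(1) by metis
  qed
  consider (word) "p = None" "\<not> q" | (both) x where "p = Some x" q
    | (syl_Nil) x where "p = Some x" "\<not> q" "e = []"
    | (syl_snoc) x e' y where "p = Some x" "\<not> q" "e = e' @ [y]"
    | (a_Nil) "p = None" q "e = []" | (a_Cons) y e' where "p = None" q "e = y # e'"
    by (metis (full_types) option.exhaust rev_exhaust list.exhaust)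
  then show ?case
  proof cases
    case word
    then have "nf p e q = wd e"
      by (simp add: nf_def pre_def suf_def)
    moreover have "wd e \<in> torsion_reps" if "e = []"
      using that by (simp add: torsion_reps_def)
    moreover have "2 * length e \<le> cost p e q"
      by (simp add: cost_def)
    ultimately show ?thesis
      by metis
  next
    case both
    \<comment> \<open>The trailing \<open>a\<close> completes the leading syllable to a further
      letter, at exactly the same cost.\<close>
    have "conj_class G (nf p e q) = conj_class G (syl x \<otimes> wd e \<otimes> a)"
      using both by (simp add: nf_def pre_def suf_def m_assoc)
    also have "\<dots> = conj_class G (wd (x # e))"
      by (subst conj_class_commute) simp_all
    finally show ?thesis
      using both by (intro exI[of _ "wd (x # e)"]) (auto simp: cost_def)
  next
    case syl_Nil
    then have "nf p e q \<in> torsion_reps"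
      by (simp add: nf_def pre_def suf_def syl_def torsion_reps_def)
    then show ?thesis
      by blast
  next
    case syl_snoc
    let ?p = "if y = x then Some (\<not> y) else None"
    \<comment> \<open>The last syllable is moved to the front, where it merges with
      \<open>syl x\<close>; its own \<open>a\<close> stays behind as the new suffix.\<close>
    have "conj_class G (nf p e q) = conj_class G (syl x \<otimes> wd e' \<otimes> a \<otimes> syl y)"
      using syl_snoc by (simp add: nf_def pre_def suf_def m_assoc wd_append)
    also have "\<dots> = conj_class G (syl y \<otimes> (syl x \<otimes> (wd e' \<otimes> a)))"
      by (subst conj_class_commute) (simp_all add: m_assoc)
    also have "\<dots> = conj_class G (nf ?p e' True)"
      by (simp add: nf_def suf_def syl_mult_assoc)
    finally show ?thesis
      by (rule reduce) (use syl_snoc in \<open>auto simp: cost_def\<close>)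
  next
    case a_Nil
    then have "nf p e q \<in> torsion_reps"
      by (simp add: nf_def pre_def suf_def torsion_reps_def)
    then show ?thesis
      by blast
  next
    case a_Cons
    have "conj_class G (nf p e q) = conj_class G (a \<otimes> (syl y \<otimes> wd e') \<otimes> a)"
      using a_Cons by (simp add: nf_def pre_def suf_def m_assoc)
    also have "\<dots> = conj_class G (nf (Some y) e' False)"
      by (subst conj_class_commute) (simp_all add: nf_def pre_def suf_def)
    finally show ?thesis
      by (rule reduce) (use a_Cons in \<open>auto simp: cost_def\<close>)
  qed
qed

lemma conj_class_list_prod:
  assumes "set xs \<subseteq> {a, b, inv b}"
  obtains h where "conj_class G (list_prod G xs) = conj_class G h"
    "h \<in> torsion_reps \<or> (\<exists>f. f \<noteq> [] \<and> 2 * length f \<le> length xs \<and> h = wd f)"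
proof -
  obtain p e q where "list_prod G xs = nf p e q" "cost p e q \<le> length xs"
    using list_prod_normal_form assms by blast
  then show ?thesis
    using that conj_class_nf[of p e q] by (metis le_trans)
qed

text \<open>6 is a common multiple of 2 and 3. Sixth powers later separate torsion from
  words.\<close>

lemma torsion_reps_pow: "h \<in> torsion_reps \<Longrightarrow> h [^] (6::nat) = \<one>"
proof -
  have 1: "a [^] (6::nat) = \<one>" "b [^] (6::nat) = \<one>"
    using bbb by (simp_all add: numeral_eq_Suc m_assoc)
  have "inv b [^] (6::nat) = inv (b [^] (6::nat))"
    by (simp add: nat_pow_inv)
  then show "h \<in> torsion_reps \<Longrightarrow> h [^] (6::nat) = \<one>"
    using 1 by (auto simp: torsion_reps_def)
qed

lemma torsion_reps_closed: "h \<in> torsion_reps \<Longrightarrow> h \<in> carrier G"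
  by (auto simp: torsion_reps_def)

lemma wd_pow_word: "wd (pow_word n e) = wd e [^] n"
  by (induction n) (simp_all add: pow_word_Suc' wd_append del: pow_word_Suc)

end

section \<open>The modular group\<close>

lemma SL2Z_simps [simp]:
  "carrier SL2Z = {M. det M = 1}" "M \<otimes>\<^bsub>SL2Z\<^esub> N = M ** N" "\<one>\<^bsub>SL2Z\<^esub> = mat 1"
  by (simp_all add: SL2Z_def)

lemma GL2Z_simps [simp]:
  "carrier GL2Z = {M. invertible M}" "M \<otimes>\<^bsub>GL2Z\<^esub> N = M ** N" "\<one>\<^bsub>GL2Z\<^esub> = mat 1"
  by (simp_all add: GL2Z_def)

lemma invertible_1 [simp]: "invertible (mat 1 :: int^2^2)"
  unfolding invertible_def by (intro exI[of _ "mat 1"]) simp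

lemma invertible_det_1: "det M = 1 \<Longrightarrow> invertible M" for M :: "int^2^2"
  unfolding invertible_def using adj_mult_self by blast

lemma group_SL2Z: "group SL2Z"
proof (rule groupI)
  fix M
  assume "M \<in> carrier SL2Z"
  then show "\<exists>N\<in>carrier SL2Z. N \<otimes>\<^bsub>SL2Z\<^esub> M = \<one>\<^bsub>SL2Z\<^esub>"
    by (intro bexI[of _ "adj M"]) (simp_all add: adj_mult_self)
qed (auto simp: det_mul matrix_mul_assoc)

lemma group_GL2Z: "group GL2Z"
proof (rule groupI)
  fix M
  assume "M \<in> carrier GL2Z"
  then obtain N where "M ** N = mat 1" "N ** M = mat 1"
    by (auto simp: invertible_def)
  then show "\<exists>N\<in>carrier GL2Z. N \<otimes>\<^bsub>GL2Z\<^esub> M = \<one>\<^bsub>GL2Z\<^esub>"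
    by (intro bexI[of _ N]) (auto simp: invertible_def)
qed (auto simp: invertible_mult matrix_mul_assoc)

lemma pm_one_normal_SL2Z: "pm_one \<lhd> SL2Z"
proof (rule group.normalI[OF group_SL2Z])
  show "subgroup pm_one SL2Z"
  proof (rule group.subgroupI[OF group_SL2Z])
    fix M assume "M \<in> pm_one"
    then have "M ** M = mat 1" "det M = 1"
      by (auto simp: pm_one_def mat_1_mk)
    then have "inv\<^bsub>SL2Z\<^esub> M = M"
      using group.inv_equality[OF group_SL2Z, of M M] by simp
    then show "inv\<^bsub>SL2Z\<^esub> M \<in> pm_one"
      using \<open>M \<in> pm_one\<close> by simp
  qed (auto simp: pm_one_def mat_1_mk)
qed (auto simp: pm_one_def r_coset_def l_coset_def)

lemma pm_one_normal_GL2Z: "pm_one \<lhd> GL2Z"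
proof (rule group.normalI[OF group_GL2Z])
  show "subgroup pm_one GL2Z"
  proof (rule group.subgroupI[OF group_GL2Z])
    fix M assume "M \<in> pm_one"
    then have "M ** M = mat 1" "invertible M"
      by (auto simp: pm_one_def mat_1_mk intro!: invertible_det_1)
    then have "inv\<^bsub>GL2Z\<^esub> M = M"
      using group.inv_equality[OF group_GL2Z, of M M] by simp
    then show "inv\<^bsub>GL2Z\<^esub> M \<in> pm_one"
      using \<open>M \<in> pm_one\<close> by simp
  qed (auto simp: pm_one_def mat_1_mk intro!: invertible_det_1)
qed (auto simp: pm_one_def r_coset_def l_coset_def)

interpretation PSL: group PSL2Z
  unfolding PSL2Z_def by (rule normal.factorgroup_is_group[OF pm_one_normal_SL2Z])

interpretation PGL: group PGL2Z
  unfolding PGL2Z_def by (rule normal.factorgroup_is_group[OF pm_one_normal_GL2Z])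

lemma proj_eq: "proj M = {M, - M}"
  by (auto simp: proj_def r_coset_def pm_one_def)

lemma proj_eq_iff: "proj M = proj N \<longleftrightarrow> M = N \<or> M = - N"
  by (auto simp: proj_eq doubleton_eq_iff)

lemma proj_uminus [simp]: "proj (- M) = proj M"
  by (auto simp: proj_eq)

lemma carrier_PSL2Z: "carrier PSL2Z = proj ` {M. det M = 1}"
  by (auto simp: PSL2Z_def FactGroup_def RCOSETS_def r_coset_def proj_eq pm_one_def)

lemma carrier_PGL2Z: "carrier PGL2Z = proj ` {M. invertible M}"
  by (auto simp: PGL2Z_def FactGroup_def RCOSETS_def r_coset_def proj_eq pm_one_def)

lemma proj_mult_PSL2Z [simp]: "proj M \<otimes>\<^bsub>PSL2Z\<^esub> proj N = proj (M ** N)"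
  by (auto simp: PSL2Z_def FactGroup_def set_mult_def proj_eq)

lemma proj_mult_PGL2Z [simp]: "proj M \<otimes>\<^bsub>PGL2Z\<^esub> proj N = proj (M ** N)"
  by (auto simp: PGL2Z_def FactGroup_def set_mult_def proj_eq)

lemma one_PSL2Z: "\<one>\<^bsub>PSL2Z\<^esub> = proj (mat 1)"
  by (auto simp: PSL2Z_def FactGroup_def proj_eq pm_one_def)

lemma one_PGL2Z: "\<one>\<^bsub>PGL2Z\<^esub> = proj (mat 1)"
  by (auto simp: PGL2Z_def FactGroup_def proj_eq pm_one_def)

lemma proj_in_PSL2Z [simp]: "det M = 1 \<Longrightarrow> proj M \<in> carrier PSL2Z"
  by (auto simp: carrier_PSL2Z)

lemma inv_PSL2Z [simp]: "det M = 1 \<Longrightarrow> inv\<^bsub>PSL2Z\<^esub> (proj M) = proj (adj M)"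
  by (rule PSL.inv_equality) (simp_all add: adj_mult_self one_PSL2Z)

lemma inv_PGL2Z: "M ** N = mat 1 \<Longrightarrow> N ** M = mat 1 \<Longrightarrow> inv\<^bsub>PGL2Z\<^esub> (proj M) = proj N"
  by (rule PGL.inv_equality) (auto simp: carrier_PGL2Z one_PGL2Z invertible_def)

lemma gen_A_eq: "gen_A = proj mA" and gen_B_eq: "gen_B = proj mB"
  and elt_w_eq: "elt_w = proj (mk 1 0 0 (-1))"
  by (simp_all add: gen_A_def gen_B_def elt_w_def mk_def)

interpretation PSL: order_2_3 PSL2Z gen_A gen_B
proof
  show "gen_A \<otimes>\<^bsub>PSL2Z\<^esub> gen_A = \<one>\<^bsub>PSL2Z\<^esub>"
    "gen_B \<otimes>\<^bsub>PSL2Z\<^esub> (gen_B \<otimes>\<^bsub>PSL2Z\<^esub> gen_B) = \<one>\<^bsub>PSL2Z\<^esub>"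
    by (simp_all add: gen_A_eq gen_B_eq one_PSL2Z proj_eq_iff mat_1_mk)
qed (simp_all add: gen_A_eq gen_B_eq)

text \<open>\<open>A B = -U\<close> and \<open>A B^-1 = L\<close>. This ties the abstract normal
  forms to the free monoid of matrices.\<close>

lemma gen_A_syl: "gen_A \<otimes>\<^bsub>PSL2Z\<^esub> PSL.syl x = proj (letter x)"
  unfolding PSL.syl_def by (simp add: gen_A_eq gen_B_eq letter_def proj_eq_iff)

lemma wd_eq: "PSL.wd e = proj (Wm e)"
proof (induction e)
  case (Cons x e)
  have "PSL.wd (x # e) = gen_A \<otimes>\<^bsub>PSL2Z\<^esub> PSL.syl x \<otimes>\<^bsub>PSL2Z\<^esub> PSL.wd e"
    by (simp add: PSL.m_assoc)
  then show ?case
    using Cons by (simp add: gen_A_syl)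
qed (simp add: one_PSL2Z)

definition gens :: "(int^2^2) set set" where
  "gens = {gen_A, gen_B, inv\<^bsub>PSL2Z\<^esub> gen_B}"

lemma generated_list_prod:
  "M \<in> generated \<Longrightarrow> \<exists>xs. set xs \<subseteq> gens \<and> list_prod PSL2Z xs = proj M"
proof (induction rule: generated.induct)
  case one
  then show ?case
    by (intro exI[of _ "[]"]) (simp add: one_PSL2Z)
next
  case (A M)
  then obtain xs where "set xs \<subseteq> gens" "list_prod PSL2Z xs = proj M"
    by blast
  then show ?case
    by (intro exI[of _ "gen_A # xs"]) (simp add: gens_def gen_A_eq)
next
  case (U M)
  then obtain xs where "set xs \<subseteq> gens" "list_prod PSL2Z xs = proj M"
    by blast
  moreover have "mA ** (mB ** M) = - (mU ** M)"
    by (cases M rule: mk_cases) simp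
  ultimately show ?case
    by (intro exI[of _ "gen_A # gen_B # xs"]) (simp add: gens_def gen_A_eq gen_B_eq)
qed simp

lemma carrier_list_prod:
  assumes "g \<in> carrier PSL2Z"
  obtains xs where "set xs \<subseteq> gens" "list_prod PSL2Z xs = g"
  using assms generated_list_prod det_1_generated by (force simp: carrier_PSL2Z)

section \<open>Conjugacy classes of words and their roots\<close>

definition cls :: "bool list \<Rightarrow> (int^2^2) set set" where
  "cls e = conj_class PSL2Z (proj (Wm e))"

lemma cls_append: "cls (xs @ ys) = cls (ys @ xs)"
  using PSL.conj_class_commute[of "proj (Wm xs)" "proj (Wm ys)"] by (simp add: cls_def Wm_append)

lemma cls_rot_equiv: "rot_equiv e f \<Longrightarrow> cls e = cls f"
  unfolding rot_equiv_def by (metis append_take_drop_id cls_append rotate_drop_take)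

text \<open>Conjugacy in \<open>PSL2Z\<close> lifts to \<open>H ** Wm e = Wm f ** H\<close> up to
  sign, which is the situation of \<open>conjugate_Wm_rot_equiv\<close>.\<close>

lemma cls_eq_iff:
  assumes "e \<noteq> []" "f \<noteq> []"
  shows "cls e = cls f \<longleftrightarrow> rot_equiv e f"
proof
  assume "cls e = cls f"
  then obtain k where "k \<in> carrier PSL2Z"
    "proj (Wm f) = k \<otimes>\<^bsub>PSL2Z\<^esub> proj (Wm e) \<otimes>\<^bsub>PSL2Z\<^esub> inv\<^bsub>PSL2Z\<^esub> k"
    using PSL.conj_class_eqD[of "proj (Wm f)" "proj (Wm e)"] by (auto simp: cls_def)
  then obtain H where H: "det H = 1" "proj (Wm f) = proj (H ** Wm e ** adj H)"
    by (auto simp: carrier_PSL2Z)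
  then have "Wm f ** H = H ** Wm e ** (adj H ** H) \<or> Wm f ** H = - (H ** Wm e ** (adj H ** H))"
    by (auto simp: proj_eq_iff matrix_mul_assoc)
  then have "H ** Wm e = Wm f ** H \<or> H ** Wm e = - (Wm f ** H)"
    using H(1) by (auto simp: adj_mult_self)
  then show "rot_equiv e f"
    using conjugate_Wm_rot_equiv H(1) assms by blast
qed (rule cls_rot_equiv)

lemma proj_Wm_eq_iff: "proj (Wm e) = proj (Wm f) \<longleftrightarrow> e = f"
  using Wm_neq_uminus by (auto simp: proj_eq_iff Wm_inject)

lemma conj_class_cases:
  assumes "g \<in> carrier PSL2Z"
  obtains (torsion) h where "h \<in> PSL.torsion_reps" "conj_class PSL2Z g = conj_class PSL2Z h"
  | (word) f where "f \<noteq> []" "conj_class PSL2Z g = cls f"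
proof -
  obtain xs where xs: "set xs \<subseteq> gens" "list_prod PSL2Z xs = g"
    using assms by (rule carrier_list_prod)
  obtain h where "conj_class PSL2Z (list_prod PSL2Z xs) = conj_class PSL2Z h"
    "h \<in> PSL.torsion_reps \<or> (\<exists>f. f \<noteq> [] \<and> 2 * length f \<le> length xs \<and> h = PSL.wd f)"
    using PSL.conj_class_list_prod xs(1) unfolding gens_def by blast
  then show ?thesis
    using xs(2) that by (auto simp: cls_def wd_eq)
qed

text \<open>Up to conjugacy the root \<open>h\<close> is torsion or a word. Torsion would make the
  sixth power of \<open>e\<close> trivial, against freeness; for a word, the classification of
  classes gives the rotation.\<close>

lemma cls_power:
  assumes "e \<noteq> []" "h \<in> carrier PSL2Z" "k > 0" "cls e = conj_class PSL2Z (h [^]\<^bsub>PSL2Z\<^esub> (k::nat))"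
  obtains f where "f \<noteq> []" "rot_equiv (pow_word k f) e"
using assms(2)
proof (cases rule: conj_class_cases)
  case (torsion h')
  have h': "h' \<in> carrier PSL2Z"
    using torsion PSL.torsion_reps_closed by blast
  have "cls e = conj_class PSL2Z (h' [^]\<^bsub>PSL2Z\<^esub> k)"
    using assms(4) PSL.conj_class_nat_pow[OF torsion(2) assms(2) h'] by simp
  then have "conj_class PSL2Z (PSL.wd e [^]\<^bsub>PSL2Z\<^esub> (6::nat)) =
      conj_class PSL2Z ((h' [^]\<^bsub>PSL2Z\<^esub> k) [^]\<^bsub>PSL2Z\<^esub> (6::nat))"
    using h' by (intro PSL.conj_class_nat_pow) (simp_all add: cls_def wd_eq)
  moreover have "(h' [^]\<^bsub>PSL2Z\<^esub> k) [^]\<^bsub>PSL2Z\<^esub> (6::nat) = \<one>\<^bsub>PSL2Z\<^esub>"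
    using PSL.torsion_reps_pow[OF torsion(1)] h'
    by (metis PSL.nat_pow_pow PSL.nat_pow_one mult.commute)
  ultimately have "PSL.wd (pow_word 6 e) = \<one>\<^bsub>PSL2Z\<^esub>"
    by (simp add: PSL.wd_pow_word PSL.conj_class_one)
  then have "proj (Wm (pow_word 6 e)) = proj (Wm [])"
    by (simp add: wd_eq one_PSL2Z)
  then have "pow_word 6 e = []"
    unfolding proj_Wm_eq_iff .
  then have "length (pow_word 6 e) = 0"
    by simp
  then show ?thesis
    using assms(1) by simp
next
  case (word f)
  have "cls e = conj_class PSL2Z (PSL.wd f [^]\<^bsub>PSL2Z\<^esub> k)"
    using assms(4) PSL.conj_class_nat_pow[of h "PSL.wd f" k] word(2) assms(2) by (simp add: cls_def wd_eq)
  then have "cls (pow_word k f) = cls e"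
    by (simp add: cls_def flip: wd_eq PSL.wd_pow_word)
  moreover have "length (pow_word k f) \<noteq> 0"
    using word(1) assms(3) by simp
  then have "pow_word k f \<noteq> []"
    by (metis list.size(3))
  ultimately have "rot_equiv (pow_word k f) e"
    using assms(1) cls_eq_iff by simp
  then show ?thesis
    using that word(1) by blast
qed

section \<open>Products of primitive hyperbolic elements\<close>

lemma prim_hyp_products_closed:
  assumes "p \<in> prim_hyp_products"
  shows "p \<in> carrier PSL2Z"
proof -
  obtain ps where ps: "p = list_prod PSL2Z (map (\<lambda>(p, k::int). p [^]\<^bsub>PSL2Z\<^esub> k) ps)"
    "fst ` set ps \<subseteq> prim_hyp"
    using assms unfolding prim_hyp_products_def by blast
  have "q [^]\<^bsub>PSL2Z\<^esub> k \<in> carrier PSL2Z" if "(q, k) \<in> set ps" for q and k :: int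
  proof (rule PSL.int_pow_closed)
    show "q \<in> carrier PSL2Z"
      using ps(2) that by (force simp: prim_hyp_def)
  qed
  then show ?thesis
    unfolding ps(1) by (intro PSL.list_prod_closed) auto
qed

text \<open>The word of a root has a length properly dividing a prime, so it is a single letter and
  \<open>e\<close> would be constant.\<close>

lemma not_proper_power_prime_length:
  assumes "prime (length e)" "\<not> (\<exists>x. e = replicate (length e) x)"
  shows "\<not> proper_power PSL2Z (proj (Wm e))"
proof
  assume "proper_power PSL2Z (proj (Wm e))"
  then obtain h k where h: "h \<in> carrier PSL2Z" "k \<ge> (2::nat)" "proj (Wm e) = h [^]\<^bsub>PSL2Z\<^esub> k"
    by (auto simp: proper_power_def)
  have "e \<noteq> []"
    using assms(1) by auto
  then obtain f where f: "f \<noteq> []" "rot_equiv (pow_word k f) e"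
    using cls_power[of e h k] h by (auto simp: cls_def)
  then have len: "length e = k * length f"
    by (auto dest: rot_equiv_length)
  then have "length f = 1"
    using assms(1) h(2) f(1) by (metis dvd_triv_left mult_cancel1 nat_dvd_1_iff_1 not_numeral_le_zero
        numeral_le_one_iff prime_nat_iff semiring_norm(69) mult.right_neutral)
  then obtain x where "f = [x]"
    by (auto simp: length_Suc_conv)
  then have "pow_word k f = replicate k x"
    by (simp add: pow_word_def concat_replicate_single)
  moreover have "rotate i (replicate k x) = replicate k x" for i
    by (induction i) auto
  ultimately have "e = replicate (length e) x"
    using f(2) len \<open>length f = 1\<close> by (auto simp: rot_equiv_def)
  then show False
    using assms(2) by blast
qed

text \<open>The traces are 3 and 4, the lengths 2 and 3 are prime, and both letters occur.\<close>

lemma prim_hyp_words: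
  assumes "e \<in> {[True, False], [True, True, False], [False, True], [False, False, True]}"
  shows "proj (Wm e) \<in> prim_hyp"
proof -
  have "\<bar>trace (Wm e)\<bar> > 2"
    using assms by (auto simp: letter_def mat_1_mk)
  then have "hyperbolic (proj (Wm e))"
    using proj_in_PSL2Z[OF det_Wm] unfolding hyperbolic_def by (metis insertI1 proj_eq)
  moreover have "\<not> proper_power PSL2Z (proj (Wm e))"
  proof (rule not_proper_power_prime_length)
    show "prime (length e)"
    proof -
      have "length e = 2 \<or> length e = 3"
        using assms by auto
      moreover have "prime (2::nat)" "prime (3::nat)"
        by simp_all
      ultimately show ?thesis
        by metis
    qed
  qed (use assms in \<open>auto simp: numeral_eq_Suc\<close>)
  ultimately show ?thesis
    by (simp add: prim_hyp_def)
qed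

text \<open>The letters are parabolic. With \<open>y\<close> the other letter,
  \<open>x = (x x y) (x y)^-1\<close> expresses them through primitive hyperbolic elements.\<close>

lemma letter_quotient:
  obtains p q where "p \<in> prim_hyp" "q \<in> prim_hyp"
    "proj (letter x) = p [^]\<^bsub>PSL2Z\<^esub> (1::int) \<otimes>\<^bsub>PSL2Z\<^esub> q [^]\<^bsub>PSL2Z\<^esub> (-1::int)"
proof
  let ?p = "proj (Wm [x, x, \<not> x])" and ?q = "proj (Wm [x, \<not> x])"
  show "?p \<in> prim_hyp" "?q \<in> prim_hyp"
    by (cases x; intro prim_hyp_words; simp)+
  have "?q [^]\<^bsub>PSL2Z\<^esub> (-1::int) = inv\<^bsub>PSL2Z\<^esub> (?q [^]\<^bsub>PSL2Z\<^esub> (1::int))"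
    by (rule PSL.int_pow_neg) (simp add: det_mul)
  then show "proj (letter x) = ?p [^]\<^bsub>PSL2Z\<^esub> (1::int) \<otimes>\<^bsub>PSL2Z\<^esub> ?q [^]\<^bsub>PSL2Z\<^esub> (-1::int)"
    by (simp add: det_mul) (auto simp: letter_def proj_eq_iff mat_1_mk)
qed

lemma proj_Wm_prim_hyp_products:
  assumes "e \<noteq> []"
  shows "proj (Wm e) \<in> prim_hyp_products"
proof -
  have "\<exists>ps. (e \<noteq> [] \<longrightarrow> ps \<noteq> []) \<and> fst ` set ps \<subseteq> prim_hyp \<and>
      list_prod PSL2Z (map (\<lambda>(p, k::int). p [^]\<^bsub>PSL2Z\<^esub> k) ps) = proj (Wm e)"
  proof (induction e)
    case Nil
    then show ?case
      by (intro exI[of _ "[]"]) (simp add: one_PSL2Z)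
  next
    case (Cons x e)
    then obtain ps where ps: "fst ` set ps \<subseteq> prim_hyp"
      "list_prod PSL2Z (map (\<lambda>(p, k::int). p [^]\<^bsub>PSL2Z\<^esub> k) ps) = proj (Wm e)"
      by blast
    obtain p q where pq: "p \<in> prim_hyp" "q \<in> prim_hyp"
      "proj (letter x) = p [^]\<^bsub>PSL2Z\<^esub> (1::int) \<otimes>\<^bsub>PSL2Z\<^esub> q [^]\<^bsub>PSL2Z\<^esub> (-1::int)"
      by (rule letter_quotient)
    then have "p \<in> carrier PSL2Z" "q \<in> carrier PSL2Z"
      by (simp_all add: prim_hyp_def)
    then have "p [^]\<^bsub>PSL2Z\<^esub> (1::int) \<otimes>\<^bsub>PSL2Z\<^esub> (q [^]\<^bsub>PSL2Z\<^esub> (-1::int) \<otimes>\<^bsub>PSL2Z\<^esub> proj (Wm e)) =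
        proj (Wm (x # e))"
      using PSL.m_assoc[of "p [^]\<^bsub>PSL2Z\<^esub> (1::int)" "q [^]\<^bsub>PSL2Z\<^esub> (-1::int)" "proj (Wm e)"]
      by (simp only: PSL.int_pow_closed proj_in_PSL2Z det_Wm flip: pq(3)) simp
    then show ?case
      using pq ps by (intro exI[of _ "(p, 1) # (q, -1) # ps"]) simp
  qed
  then show ?thesis
    using assms unfolding prim_hyp_products_def by (auto simp: eq_commute)
qed

section \<open>Ambiguous classes are reversible words\<close>

text \<open>Conjugation by \<open>diag(1, -1)\<close>, a lift of \<open>elt_w\<close>.\<close>

definition refl_conj :: "int^2^2 \<Rightarrow> int^2^2" where
  "refl_conj M = mk (M$1$1) (- M$1$2) (- M$2$1) (M$2$2)"

lemma refl_conj_mk [simp]: "refl_conj (mk a b c d) = mk a (-b) (-c) d"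
  by (simp add: refl_conj_def)

lemma refl_conj_mult: "refl_conj (M ** N) = refl_conj M ** refl_conj N"
  by (cases M rule: mk_cases; cases N rule: mk_cases) simp

lemma refl_conj_adj: "refl_conj (adj M) = adj (refl_conj M)"
  by (cases M rule: mk_cases) simp

lemma refl_conj_involution [simp]: "refl_conj (refl_conj M) = M"
  by (cases M rule: mk_cases) simp

lemma adj_involution [simp]: "adj (adj M) = M"
  by (cases M rule: mk_cases) simp

lemma det_refl_conj [simp]: "det (refl_conj M) = det M"
  by (cases M rule: mk_cases) simp

lemma phi_Amb_proj: "det M = 1 \<Longrightarrow> phi_Amb (proj M) = proj (refl_conj (adj M))"
proof -
  assume "det M = 1"
  then have "inv\<^bsub>PGL2Z\<^esub> (proj M) = proj (adj M)"
    by (intro inv_PGL2Z adj_mult_self)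
  moreover have "inv\<^bsub>PGL2Z\<^esub> elt_w = elt_w"
    unfolding elt_w_eq by (rule inv_PGL2Z) (simp_all add: mat_1_mk)
  moreover have "mk 1 0 0 (-1) ** adj M ** mk 1 0 0 (-1) = refl_conj (adj M)"
    by (cases M rule: mk_cases) simp
  ultimately show ?thesis
    by (simp add: phi_Amb_def elt_w_eq)
qed

lemma conj_class_proj:
  "det M = 1 \<Longrightarrow> conj_class PSL2Z (proj M) = (\<lambda>H. proj (H ** M ** adj H)) ` {H. det H = 1}"
proof -
  assume "det M = 1"
  have "conj_class PSL2Z (proj M) = (\<lambda>h. h \<otimes>\<^bsub>PSL2Z\<^esub> proj M \<otimes>\<^bsub>PSL2Z\<^esub> inv\<^bsub>PSL2Z\<^esub> h) ` carrier PSL2Z"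
    by (auto simp: conj_class_def)
  then show ?thesis
    unfolding carrier_PSL2Z image_image by (simp cong: image_cong_simp)
qed

text \<open>The conjugator \<open>H\<close> is replaced by \<open>refl_conj H\<close>, which again
  runs through all matrices of determinant 1.\<close>

lemma phi_Amb_conj_class:
  assumes "det M = 1"
  shows "phi_Amb ` conj_class PSL2Z (proj M) = conj_class PSL2Z (proj (refl_conj (adj M)))"
proof -
  have "phi_Amb (proj (H ** M ** adj H)) =
      proj (refl_conj H ** refl_conj (adj M) ** adj (refl_conj H))" if "det H = 1" for H
    using that assms
    by (simp add: phi_Amb_proj det_mul adj_mult refl_conj_mult refl_conj_adj matrix_mul_assoc)
  then have "phi_Amb ` conj_class PSL2Z (proj M) =
      (\<lambda>H. proj (H ** refl_conj (adj M) ** adj H)) ` refl_conj ` {H. det H = 1}"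
    using assms by (auto simp: conj_class_proj image_image)
  also have "refl_conj ` {H. det H = 1} = {H. det H = 1}"
    by (force intro: image_eqI[where x = "refl_conj _"])
  also have "(\<lambda>H. proj (H ** refl_conj (adj M) ** adj H)) ` {H. det H = 1} =
      conj_class PSL2Z (proj (refl_conj (adj M)))"
    using assms by (simp add: conj_class_proj)
  finally show ?thesis .
qed

text \<open>This anti-automorphism fixes both letters, so it reverses products of letters.\<close>

lemma refl_conj_adj_Wm: "refl_conj (adj (Wm e)) = Wm (rev e)"
proof (induction e)
  case (Cons x e)
  have "refl_conj (adj (letter x)) = letter x"
    by (simp add: letter_def)
  then show ?case
    using Cons by (simp add: adj_mult refl_conj_mult Wm_append)
qed (simp add: mat_1_mk)

lemma phi_Amb_cls: "phi_Amb ` cls e = cls (rev e)"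
  by (simp add: cls_def phi_Amb_conj_class refl_conj_adj_Wm)

text \<open>Every nonempty word lies in \<open>prim_hyp_products\<close>, so only the invariance
  under reversal remains.\<close>

lemma ambiguous_cls_iff:
  assumes "e \<noteq> []"
  shows "ambiguous_class (cls e) \<longleftrightarrow> rot_equiv e (rev e)"
proof
  assume "ambiguous_class (cls e)"
  then have "cls e = cls (rev e)"
    by (simp add: ambiguous_class_def phi_Amb_cls)
  then show "rot_equiv e (rev e)"
    using assms by (simp add: cls_eq_iff)
next
  assume "rot_equiv e (rev e)"
  then have "cls e = cls (rev e)"
    by (rule cls_rot_equiv)
  then show "ambiguous_class (cls e)"
    using proj_Wm_prim_hyp_products[OF assms] phi_Amb_cls[of e]
    unfolding ambiguous_class_def cls_def by auto
qed

section \<open>Word length and class length\<close>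

lemma word_length_le: "set xs \<subseteq> gens \<Longrightarrow> word_length (list_prod PSL2Z xs) \<le> length xs"
  unfolding word_length_def gens_def by (rule Least_le) blast

lemma word_length_witness:
  assumes "g \<in> carrier PSL2Z"
  obtains xs where "set xs \<subseteq> gens" "list_prod PSL2Z xs = g" "length xs = word_length g"
proof -
  let ?P = "\<lambda>n. \<exists>xs. length xs = n \<and> set xs \<subseteq> gens \<and> list_prod PSL2Z xs = g"
  have "\<exists>n. ?P n"
    using carrier_list_prod[OF assms] by metis
  then have "?P (LEAST n. ?P n)"
    by (rule LeastI_ex)
  then show ?thesis
    using that unfolding word_length_def gens_def by blast
qed

text \<open>Each letter is spelled with two generators. The reverse direction is
  \<open>class_length_cases\<close>.\<close>

lemma class_length_cls: "class_length (cls e) \<le> 2 * length e"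
proof -
  have "\<exists>xs. set xs \<subseteq> gens \<and> length xs = 2 * length e \<and> list_prod PSL2Z xs = PSL.wd e"
  proof (induction e)
    case (Cons x e)
    then obtain xs where "set xs \<subseteq> gens" "length xs = 2 * length e"
      "list_prod PSL2Z xs = PSL.wd e"
      by blast
    then show ?case
      by (intro exI[of _ "gen_A # PSL.syl x # xs"]) (auto simp: gens_def PSL.syl_def)
  qed simp
  then have "word_length (PSL.wd e) \<le> 2 * length e"
    using word_length_le by metis
  moreover have "PSL.wd e \<in> cls e"
    unfolding cls_def wd_eq by (rule PSL.conj_class_self) simp
  then have "class_length (cls e) \<le> word_length (PSL.wd e)"
    unfolding class_length_def by (intro Least_le) blast
  ultimately show ?thesis
    by simp
qed

text \<open>A shortest element of the class is a product of at most \<open>2 * t\<close> generators;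
  cyclic reduction pairs them into at most \<open>t\<close> letters.\<close>

lemma class_length_cases:
  assumes "g \<in> carrier PSL2Z" "class_length (conj_class PSL2Z g) \<le> 2 * t"
  obtains (torsion) h where "h \<in> PSL.torsion_reps" "conj_class PSL2Z g = conj_class PSL2Z h"
  | (word) f where "f \<noteq> []" "length f \<le> t" "conj_class PSL2Z g = cls f"
proof -
  let ?C = "conj_class PSL2Z g"
  have "\<exists>n. \<exists>h\<in>?C. word_length h = n"
    using PSL.conj_class_self[OF assms(1)] by blast
  then have "\<exists>h\<in>?C. word_length h = class_length ?C"
    unfolding class_length_def by (rule LeastI_ex)
  then obtain h where h: "h \<in> ?C" "word_length h \<le> 2 * t"
    using assms(2) by metis
  have "h \<in> carrier PSL2Z"
    using h(1) PSL.conj_class_subset assms(1) by blast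
  then obtain xs where xs: "set xs \<subseteq> gens" "list_prod PSL2Z xs = h" "length xs = word_length h"
    by (rule word_length_witness)
  have C: "conj_class PSL2Z h = ?C"
    using PSL.conj_class_eqI h(1) assms(1) by blast
  obtain h' where "conj_class PSL2Z (list_prod PSL2Z xs) = conj_class PSL2Z h'"
    "h' \<in> PSL.torsion_reps \<or> (\<exists>f. f \<noteq> [] \<and> 2 * length f \<le> length xs \<and> h' = PSL.wd f)"
    using PSL.conj_class_list_prod xs(1) unfolding gens_def by blast
  then consider "h' \<in> PSL.torsion_reps" "?C = conj_class PSL2Z h'" |
      f where "f \<noteq> []" "2 * length f \<le> length xs" "?C = cls f"
    using xs(2) C by (auto simp: cls_def wd_eq)
  then show ?thesis
  proof cases
    case 2
    then show ?thesis
      using that(2) xs(3) h(2) by simp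
  qed (use that in blast)
qed

section \<open>Counting\<close>

text \<open>Whichever of these classes are ambiguous, they only affect an additive constant.\<close>

definition torsion_classes :: "(int^2^2) set set set" where
  "torsion_classes = conj_class PSL2Z ` PSL.torsion_reps"

lemma torsion_classes: "finite torsion_classes" "card torsion_classes \<le> 4"
proof -
  have "PSL.torsion_reps = set [\<one>\<^bsub>PSL2Z\<^esub>, gen_A, gen_B, inv\<^bsub>PSL2Z\<^esub> gen_B]"
    by (simp add: PSL.torsion_reps_def)
  then have 1: "finite PSL.torsion_reps" "card PSL.torsion_reps \<le> 4"
    using card_length[of "[\<one>\<^bsub>PSL2Z\<^esub>, gen_A, gen_B, inv\<^bsub>PSL2Z\<^esub> gen_B]"] by simp_all
  show "finite torsion_classes" "card torsion_classes \<le> 4"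
    using 1 card_image_le[OF 1(1), of "conj_class PSL2Z"] by (simp_all add: torsion_classes_def)
qed

lemma ambiguous_upto_cases:
  assumes "C \<in> ambiguous_upto (2 * t)"
  obtains (torsion) "C \<in> torsion_classes"
  | (word) e where "e \<noteq> []" "length e \<le> t" "rot_equiv e (rev e)" "C = cls e"
proof -
  obtain p where p: "p \<in> carrier PSL2Z" "C = conj_class PSL2Z p"
    using assms prim_hyp_products_closed by (auto simp: ambiguous_upto_def ambiguous_class_def)
  have len: "class_length (conj_class PSL2Z p) \<le> 2 * t"
    using assms p(2) by (simp add: ambiguous_upto_def)
  show ?thesis
    using p(1) len
  proof (cases rule: class_length_cases)
    case (torsion h)
    then show ?thesis
      using that(1) p(2) by (simp add: torsion_classes_def)
  next
    case (word f)
    then have "ambiguous_class (cls f)"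
      using assms p(2) by (simp add: ambiguous_upto_def)
    then show ?thesis
      using that(2) word p(2) ambiguous_cls_iff by metis
  qed
qed

lemma rep_in_upto:
  assumes "rot_equiv e (rev e)" "length e \<le> t"
  obtains r where "r \<in> reversible_reps_upto t" "rot_equiv e r"
proof -
  obtain r where "r \<in> reversible_reps (length e)" "rot_equiv e r"
    using exists_reversible_rep[OF assms(1)] by blast
  then show ?thesis
    using that assms(2) unfolding reversible_reps_upto_def by blast
qed

lemma ambiguous_upto_subset:
  "ambiguous_upto (2 * t) \<subseteq> torsion_classes \<union> cls ` reversible_reps_upto t"
proof
  fix C
  assume "C \<in> ambiguous_upto (2 * t)"
  then show "C \<in> torsion_classes \<union> cls ` reversible_reps_upto t"
  proof (cases rule: ambiguous_upto_cases)
    case (word e)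
    then show ?thesis
      using rep_in_upto cls_rot_equiv by (metis UnI2 imageI)
  qed simp
qed

lemma finite_ambiguous_upto: "finite (ambiguous_upto (2 * t))"
  by (rule finite_subset[OF ambiguous_upto_subset])
    (simp add: torsion_classes finite_reversible_reps_upto)

lemma card_ambiguous_upto_le: "card (ambiguous_upto (2 * t)) \<le> 4 + 16 * 2 ^ (t div 2)"
proof -
  have "card (ambiguous_upto (2 * t)) \<le> card (torsion_classes \<union> cls ` reversible_reps_upto t)"
    by (intro card_mono ambiguous_upto_subset) (simp add: torsion_classes finite_reversible_reps_upto)
  also have "\<dots> \<le> card torsion_classes + card (cls ` reversible_reps_upto t)"
    by (rule card_Un_le)
  also have "\<dots> \<le> 4 + 16 * 2 ^ (t div 2)"
    using card_image_le[OF finite_reversible_reps_upto, of cls t] card_reversible_reps_upto[of t]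
      torsion_classes(2) by linarith
  finally show ?thesis .
qed

text \<open>The root of a reversible word is itself reversible, and replacing it by its
  representative only rotates the power.\<close>

lemma non_primitive_subset:
  "ambiguous_upto (2 * t) - primitive_ambiguous_upto (2 * t)
    \<subseteq> torsion_classes \<union> (\<lambda>(m, r). cls (pow_word m r)) ` ({..t} \<times> reversible_reps_upto (t div 2))"
proof
  fix C
  assume C: "C \<in> ambiguous_upto (2 * t) - primitive_ambiguous_upto (2 * t)"
  then have "C \<in> ambiguous_upto (2 * t)"
    by blast
  then show "C \<in> torsion_classes \<union>
      (\<lambda>(m, r). cls (pow_word m r)) ` ({..t} \<times> reversible_reps_upto (t div 2))"
  proof (cases rule: ambiguous_upto_cases)
    case (word e)
    obtain g h k where g: "g \<in> C" "h \<in> carrier PSL2Z" "k \<ge> (2::nat)" "g = h [^]\<^bsub>PSL2Z\<^esub> k"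
      using C by (auto simp: primitive_ambiguous_upto_def primitive_class_def proper_power_def)
    have "conj_class PSL2Z g = cls e"
      using g(1) word(4) PSL.conj_class_eqI[of g "proj (Wm e)"] by (simp add: cls_def)
    then obtain f where f: "f \<noteq> []" "rot_equiv (pow_word k f) e"
      using cls_power[OF word(1) g(2), of k] g(3,4) by auto
    have "rot_equiv (rev (pow_word k f)) (rev e)"
      using f(2) by (rule rot_equiv_rev)
    then have "rot_equiv (pow_word k f) (rev (pow_word k f))"
      using f(2) word(3) rot_equiv_sym rot_equiv_trans by metis
    then have "rot_equiv f (rev f)"
      using rot_equiv_rev_root g(3) by fastforce
    moreover have len: "k * length f \<le> t"
      using rot_equiv_length[OF f(2)] word(2) by simp
    \<comment> \<open>\<open>k \<ge> 2\<close> bounds the length of the root, and its nonemptiness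
      bounds the exponent.\<close>
    have "2 * length f \<le> k * length f" "k * 1 \<le> k * length f"
      using g(3) f(1) by (intro mult_le_mono; simp add: Suc_leI)+
    then have "length f \<le> t div 2" "k \<le> t"
      using len by linarith+
    ultimately obtain r where r: "r \<in> reversible_reps_upto (t div 2)" "rot_equiv f r"
      using rep_in_upto by metis
    have "C = cls (pow_word k r)"
      using word(4) f(2) r(2) rot_equiv_pow_word cls_rot_equiv by metis
    then show ?thesis
      using \<open>k \<le> t\<close> r(1) by force
  qed simp
qed

text \<open>There are \<open>t + 1\<close> possible exponents, and the roots of length at most
  \<open>t div 2\<close> give the other factor.\<close>

lemma card_non_primitive_le:
  "card (ambiguous_upto (2 * t)) - card (primitive_ambiguous_upto (2 * t))
    \<le> 4 + 16 * (t + 1) * 2 ^ (t div 2 div 2)"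
proof -
  let ?R = "reversible_reps_upto (t div 2) :: bool list set"
  let ?f = "\<lambda>(m, r). cls (pow_word m r)"
  have fin: "finite ({..t} \<times> ?R)"
    by (simp add: finite_reversible_reps_upto)
  have "card (ambiguous_upto (2 * t)) - card (primitive_ambiguous_upto (2 * t))
      \<le> card (ambiguous_upto (2 * t) - primitive_ambiguous_upto (2 * t))"
    by (intro diff_card_le_card_Diff finite_subset[OF _ finite_ambiguous_upto])
      (auto simp: primitive_ambiguous_upto_def)
  also have "\<dots> \<le> card (torsion_classes \<union> ?f ` ({..t} \<times> ?R))"
    by (intro card_mono non_primitive_subset) (simp add: torsion_classes finite_reversible_reps_upto)
  also have "\<dots> \<le> card torsion_classes + card (?f ` ({..t} \<times> ?R))"
    by (rule card_Un_le)
  also have "\<dots> \<le> 4 + card ({..t} \<times> ?R)"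
    using torsion_classes(2) card_image_le[OF fin, of ?f] by linarith
  also have "card ({..t} \<times> ?R) = (t + 1) * card ?R"
    by (simp add: card_cartesian_product)
  also have "4 + (t + 1) * card ?R \<le> 4 + (t + 1) * (16 * 2 ^ (t div 2 div 2))"
    by (intro add_left_mono mult_left_mono card_reversible_reps_upto) simp
  finally show ?thesis
    by (simp only: ac_simps)
qed

text \<open>Distinct palindromes of the same odd length are not rotations of each other, so their
  classes are distinct.\<close>

lemma card_ambiguous_upto_ge:
  assumes "2 * m + 1 \<le> t"
  shows "2 ^ Suc m \<le> card (ambiguous_upto (2 * t))"
proof -
  let ?P = "palindromes (2 * m + 1) :: bool list set"
  have P: "length e = 2 * m + 1" "rev e = e" "e \<noteq> []" if "e \<in> ?P" for e
    using that by (auto simp: palindromes_def)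
  have "inj_on cls ?P"
  proof (rule inj_onI)
    fix e f
    assume ef: "e \<in> ?P" "f \<in> ?P" "cls e = cls f"
    then have "rot_equiv e f"
      using P(3) cls_eq_iff by blast
    then show "e = f"
      using rot_equiv_odd_palindromes[of e f] P ef(1,2) by simp
  qed
  moreover have "cls ` ?P \<subseteq> ambiguous_upto (2 * t)"
  proof clarify
    fix e
    assume e: "e \<in> ?P"
    have "rot_equiv e (rev e)"
      unfolding rot_equiv_def P(2)[OF e] by (intro exI[of _ 0]) simp
    then show "cls e \<in> ambiguous_upto (2 * t)"
      using ambiguous_cls_iff[OF P(3)[OF e]] class_length_cls[of e] P(1)[OF e] assms
      by (simp add: ambiguous_upto_def)
  qed
  ultimately have "card ?P \<le> card (ambiguous_upto (2 * t))"
    using card_inj_on_le finite_ambiguous_upto by blast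
  then show ?thesis
    using card_odd_palindromes_ge[of m] by linarith
qed

section \<open>Real-valued bounds and asymptotics\<close>

lemma ambiguous_upto_bounds:
  "real (card (ambiguous_upto (2 * t))) \<le> 4 + 16 * 2 powr (real t / 2)"
  "t \<ge> 1 \<Longrightarrow> 2 powr (real t / 2) \<le> real (card (ambiguous_upto (2 * t)))"
proof -
  have pow: "real (2 ^ n) = 2 powr real n" for n
    by (simp add: powr_realpow)
  have "real (card (ambiguous_upto (2 * t))) \<le> real (4 + 16 * 2 ^ (t div 2))"
    using card_ambiguous_upto_le of_nat_mono by blast
  also have "\<dots> = 4 + 16 * 2 powr real (t div 2)"
    using pow by simp
  also have "\<dots> \<le> 4 + 16 * 2 powr (real t / 2)"
    by (intro add_left_mono mult_left_mono powr_mono) linarith+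
  finally show "real (card (ambiguous_upto (2 * t))) \<le> 4 + 16 * 2 powr (real t / 2)" .
  assume "t \<ge> 1"
  \<comment> \<open>The largest \<open>m\<close> with \<open>2 * m + 1 \<le> t\<close>; for either
    parity of \<open>t\<close> the exponent \<open>m + 1\<close> is still at least
    \<open>t / 2\<close>.\<close>
  define m where "m = (t - 1) div 2"
  have m: "2 * m + 1 \<le> t" "real t / 2 \<le> real (Suc m)"
    using \<open>t \<ge> 1\<close> unfolding m_def by linarith+
  have "2 powr (real t / 2) \<le> 2 powr real (Suc m)"
    using m(2) by (intro powr_mono) auto
  also have "\<dots> = real (2 ^ Suc m)"
    using pow by metis
  also have "\<dots> \<le> real (card (ambiguous_upto (2 * t)))"
    using card_ambiguous_upto_ge[OF m(1)] of_nat_mono by blast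
  finally show "2 powr (real t / 2) \<le> real (card (ambiguous_upto (2 * t)))" .
qed

lemma non_primitive_bound:
  "real (card (ambiguous_upto (2 * t))) - real (card (primitive_ambiguous_upto (2 * t)))
    \<le> 4 + 16 * (real t + 1) * 2 powr (real t / 4)"
proof -
  have "real (card (ambiguous_upto (2 * t))) - real (card (primitive_ambiguous_upto (2 * t)))
      \<le> real (card (ambiguous_upto (2 * t)) - card (primitive_ambiguous_upto (2 * t)))"
    by linarith
  also have "\<dots> \<le> real (4 + 16 * (t + 1) * 2 ^ (t div 2 div 2))"
    using card_non_primitive_le of_nat_mono by blast
  also have "\<dots> = 4 + 16 * (real t + 1) * 2 powr real (t div 2 div 2)"
    by (simp add: powr_realpow)
  also have "\<dots> \<le> 4 + 16 * (real t + 1) * 2 powr (real t / 4)"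
    by (intro add_left_mono mult_left_mono powr_mono) (linarith, simp_all)
  finally show ?thesis .
qed

theorem theorem1p2:
  shows "(\<lambda>t. real (card (ambiguous_upto (2 * t)))) \<simeq> (\<lambda>t. 2 powr (real t / 2)) \<and>
    (\<lambda>t. real (card (primitive_ambiguous_upto (2 * t))) / real (card (ambiguous_upto (2 * t))))
      \<longlonglongrightarrow> 1"
proof
  show "(\<lambda>t. real (card (ambiguous_upto (2 * t)))) \<simeq> (\<lambda>t. 2 powr (real t / 2))"
    unfolding growth_equiv_def
  \<comment> \<open>The additive constant in the lower bound has to be positive. It is taken from
    half of \<open>2 powr (real t / 2)\<close>, which is at least 1.\<close>
  proof (rule exI[of _ "1/2"], rule conjI, simp, rule exI[of _ 16], rule conjI, simp,
      rule exI[of _ "1/2"], rule conjI, simp, rule exI[of _ 4], rule conjI, simp,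
      rule exI[of _ 1], rule conjI, simp, intro allI impI conjI)
    fix t
    assume "1 \<le> real t"
    then have "2 powr (real t / 2) \<le> real (card (ambiguous_upto (2 * t)))"
      using ambiguous_upto_bounds(2) by simp
    moreover have "1 \<le> 2 powr (real t / 2)"
      by (rule ge_one_powr_ge_zero) auto
    ultimately show "1 / 2 * 2 powr (real t / 2) + 1 / 2 \<le> real (card (ambiguous_upto (2 * t)))"
      by linarith
    show "real (card (ambiguous_upto (2 * t))) \<le> 16 * 2 powr (real t / 2) + 4"
      using ambiguous_upto_bounds(1)[of t] by linarith
  qed
next
  let ?a = "\<lambda>t. real (card (ambiguous_upto (2 * t)))"
  let ?p = "\<lambda>t. real (card (primitive_ambiguous_upto (2 * t)))"
  \<comment> \<open>The bound for nonprimitive classes over the lower bound for all classes, of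
    order \<open>t * 2 powr (- t / 4)\<close>.\<close>
  let ?e = "\<lambda>t::nat. (4 + 16 * (real t + 1) * 2 powr (real t / 4)) / 2 powr (real t / 2)"
  have "1 - ?e t \<le> ?p t / ?a t \<and> ?p t / ?a t \<le> 1" if "t \<ge> 1" for t
  proof -
    have a: "2 powr (real t / 2) \<le> ?a t"
      using ambiguous_upto_bounds(2) that by blast
    moreover have pos: "0 < (2::real) powr (real t / 2)"
      by simp
    ultimately have "0 < ?a t"
      by linarith
    have "?p t \<le> ?a t"
      by (intro of_nat_mono card_mono finite_ambiguous_upto) (auto simp: primitive_ambiguous_upto_def)
    then have "?p t / ?a t \<le> 1"
      using \<open>0 < ?a t\<close> by simp
    moreover have "1 - ?p t / ?a t = (?a t - ?p t) / ?a t"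
      using \<open>0 < ?a t\<close> by (simp add: diff_divide_distrib)
    moreover have "(?a t - ?p t) / ?a t \<le> ?e t"
      using non_primitive_bound[of t] a pos by (intro frac_le) auto
    ultimately show ?thesis
      by linarith
  qed
  then have "eventually (\<lambda>t. 1 - ?e t \<le> ?p t / ?a t) sequentially"
    "eventually (\<lambda>t. ?p t / ?a t \<le> 1) sequentially"
    by (auto intro: eventually_sequentiallyI[of 1])
  moreover have "(\<lambda>t. 1 - ?e t) \<longlonglongrightarrow> 1"
    by real_asymp
  ultimately show "(\<lambda>t. ?p t / ?a t) \<longlonglongrightarrow> 1"
    using tendsto_sandwich[of "\<lambda>t. 1 - ?e t" _ sequentially "\<lambda>_. 1" 1] by simp
qed

end
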